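(* Let $\Bbbk$ be a field. If $\Delta$ is a pure simplicial complex such that $\operatorname{depth}\Bbbk[\Delta]<\dim\Bbbk[\Delta]-1$, then $\Delta$ does not have a Cohen--Macaulay extender (over $\Bbbk$).
   Context: All simplicial complexes are finite: a simplicial complex is a collection of finite subsets of a finite ground set, closed under taking subsets; $\dim\sigma=|\sigma|-1$, and a $d$-dimensional complex ($d\ge-1$) contains the empty face. It is pure if all its maximal faces have the same dimension. $\Bbbk[\Delta]=\Bbbk[x_1,\dots,x_n]/I_\Delta$ is the Stanley--Reisner ring, where $I_\Delta$ is the ideal generated by the squarefree monomials of non-faces of $\Delta$; for $\dim\Delta=d$ one has $\dim\Bbbk[\Delta]=d+1$. A complex $\Gamma$ is Cohen--Macaulay (over $\Bbbk$) if $\operatorname{depth}\Bbbk[\Gamma]=\dim\Bbbk[\Gamma]$; equivalently, $\tilde H_i(\operatorname{lk}_\Gamma(\sigma);\Bbbk)=0$ for all $\sigma\in\Gamma$ and all $i\ne\dim\Gamma-|\sigma|$, where $\operatorname{lk}_\Gamma(\sigma)=\{\tau\in\Gamma : \sigma\cup\tau\in\Gamma,\ \sigma\cap\tau=\varnothing\}$. For a subcomplex $\Delta\subseteq\Gamma$ with $\dim\Gamma=d$, the relative complex $(\Gamma,\Delta)$ (the faces of $\Gamma$ not in $\Delta$) is relative Cohen--Macaulay if $I_\Delta/I_\Gamma$ is a Cohen--Macaulay module over the polynomial ring $\Bbbk[\mathbf x]$ on the vertices of $\Gamma$ (the zero module being allowed). Equivalently, for every $\sigma\in\Gamma$ the relative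 homology $\tilde H_i(\operatorname{lk}_\Gamma(\sigma),\operatorname{lk}_\Delta(\sigma);\Bbbk)$ vanishes except possibly when $|\sigma|+i=d$, where $\operatorname{lk}_\Delta(\sigma)$ is the void complex if $\sigma\notin\Delta$, in which case the relative homology is $\tilde H_i(\operatorname{lk}_\Gamma(\sigma);\Bbbk)$. A Cohen--Macaulay extender for a pure $d$-dimensional complex $\Delta$ is a $d$-dimensional complex $\Gamma$ such that $\Delta\subseteq\Gamma$, $\Gamma$ is Cohen--Macaulay, and $(\Gamma,\Delta)$ is relative Cohen--Macaulay. $\Gamma$ may use more vertices than $\Delta$. *)

theory Defs
  imports
    "HOL-Library.Poly_Mapping"
    "HOL-Library.Extended_Nat"
    "HOL-Algebra.QuotRing"
    "HOL-Algebra.Module"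
begin

section \<open>Krull dimension, depth and Cohen--Macaulay modules\<close>

text \<open>The zero ring has no prime ideals; with this definition its dimension is 0.\<close>

definition krull_dim :: "('a, 'm) ring_scheme \<Rightarrow> enat" where
  "krull_dim R = Sup {enat n | n. \<exists>P :: nat \<Rightarrow> 'a set.
     (\<forall>i\<le>n. primeideal (P i) R) \<and> (\<forall>i<n. P i \<subset> P (Suc i))}"

definition annihilator :: "('a, 'm) ring_scheme \<Rightarrow> ('a, 'b, 'n) module_scheme \<Rightarrow> 'a set" where
  "annihilator R M = {r \<in> carrier R. \<forall>x\<in>carrier M. r \<odot>\<^bsub>M\<^esub> x = \<zero>\<^bsub>M\<^esub>}"

definition module_dim :: "('a, 'm) ring_scheme \<Rightarrow> ('a, 'b, 'n) module_scheme \<Rightarrow> enat" where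
  "module_dim R M = krull_dim (R Quot (annihilator R M))"

text \<open>The submodule \<open>(r\<^sub>1, \<dots>, r\<^sub>k) M\<close> of \<open>M\<close>.\<close>

definition list_smult :: "'a list \<Rightarrow> ('a, 'b, 'n) module_scheme \<Rightarrow> 'b set" where
  "list_smult rs M = {(\<Oplus>\<^bsub>M\<^esub>j\<in>{..<length rs}. (rs ! j) \<odot>\<^bsub>M\<^esub> x j) | x.
     x \<in> {..<length rs} \<rightarrow> carrier M}"

text \<open>The first condition says that multiplication by \<open>r\<^sub>i\<close> is injective on the quotient
  \<open>M / (r\<^sub>1, \<dots>, r\<^sub>i\<^sub>-\<^sub>1) M\<close>.\<close>

definition regular_sequence ::
  "('a, 'm) ring_scheme \<Rightarrow> ('a, 'b, 'n) module_scheme \<Rightarrow> 'a list \<Rightarrow> bool" where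
  "regular_sequence R M rs \<longleftrightarrow>
     set rs \<subseteq> carrier R \<and>
     (\<forall>i<length rs. \<forall>x\<in>carrier M.
        (rs ! i) \<odot>\<^bsub>M\<^esub> x \<in> list_smult (take i rs) M \<longrightarrow> x \<in> list_smult (take i rs) M) \<and>
     list_smult rs M \<noteq> carrier M"

text \<open>The zero module has no regular sequences, not even the empty one, and so gets depth 0.\<close>

definition depth ::
  "('a, 'm) ring_scheme \<Rightarrow> 'a set \<Rightarrow> ('a, 'b, 'n) module_scheme \<Rightarrow> enat" where
  "depth R I M = Sup {enat (length rs) | rs. set rs \<subseteq> I \<and> regular_sequence R M rs}"

text \<open>For ideals \<open>I \<subseteq> J\<close> of \<open>R\<close>, the \<open>R\<close>-module \<open>J / I\<close>.  The fields
  \<open>mult\<close> and \<open>one\<close> exist because module records extend ring records; they play no role.\<close>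

definition quotient_module :: "('a, 'm) ring_scheme \<Rightarrow> 'a set \<Rightarrow> 'a set \<Rightarrow> ('a, 'a set) module" where
  "quotient_module R J I =
     \<lparr>carrier = (\<lambda>a. I +>\<^bsub>R\<^esub> a) ` J, mult = rcoset_mult R I, one = I +>\<^bsub>R\<^esub> \<one>\<^bsub>R\<^esub>,
      zero = I, add = set_add R, smult = (\<lambda>r. rcoset_mult R I (I +>\<^bsub>R\<^esub> r))\<rparr>"

section \<open>Simplicial complexes\<close>

definition simplicial_complex :: "'v set set \<Rightarrow> bool" where
  "simplicial_complex \<Delta> \<longleftrightarrow> finite (\<Union>\<Delta>) \<and> (\<forall>\<sigma>\<in>\<Delta>. \<forall>\<tau>. \<tau> \<subseteq> \<sigma> \<longrightarrow> \<tau> \<in> \<Delta>)"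

definition facets :: "'v set set \<Rightarrow> 'v set set" where
  "facets \<Delta> = {\<sigma> \<in> \<Delta>. \<forall>\<tau>\<in>\<Delta>. \<sigma> \<subseteq> \<tau> \<longrightarrow> \<tau> = \<sigma>}"

definition face_dim :: "'v set \<Rightarrow> int" where
  "face_dim \<sigma> = int (card \<sigma>) - 1"

text \<open>Only meaningful for complexes that contain the empty face.\<close>

definition complex_dim :: "'v set set \<Rightarrow> int" where
  "complex_dim \<Delta> = Max (face_dim ` \<Delta>)"

definition pure_complex :: "'v set set \<Rightarrow> bool" where
  "pure_complex \<Delta> \<longleftrightarrow> (\<forall>\<sigma>\<in>facets \<Delta>. \<forall>\<tau>\<in>facets \<Delta>. face_dim \<sigma> = face_dim \<tau>)"

section \<open>Stanley--Reisner rings\<close>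

text \<open>\<open>poly_ring k V\<close> is the polynomial ring over the field \<open>'k\<close> in the variables indexed by
  \<open>V\<close>.  A monomial is a finitely supported exponent vector \<open>'v \<Rightarrow>\<^sub>0 nat\<close>, a polynomial a finitely
  supported map from monomials to coefficients.\<close>

definition poly_ring :: "'k::field itself \<Rightarrow> 'v set \<Rightarrow> (('v \<Rightarrow>\<^sub>0 nat) \<Rightarrow>\<^sub>0 'k) ring" where
  "poly_ring k V =
     \<lparr>carrier = {p. \<forall>m\<in>Poly_Mapping.keys p. Poly_Mapping.keys m \<subseteq> V},
      mult = (*), one = 1, zero = 0, add = (+)\<rparr>"

definition pvar :: "'k::field itself \<Rightarrow> 'v \<Rightarrow> (('v \<Rightarrow>\<^sub>0 nat) \<Rightarrow>\<^sub>0 'k)" where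
  "pvar k v = Poly_Mapping.single (Poly_Mapping.single v 1) 1"

definition irrelevant_ideal :: "'k::field itself \<Rightarrow> 'v set \<Rightarrow> (('v \<Rightarrow>\<^sub>0 nat) \<Rightarrow>\<^sub>0 'k) set" where
  "irrelevant_ideal k V = Idl\<^bsub>poly_ring k V\<^esub> (pvar k ` V)"

text \<open>The vertex set \<open>V\<close> is a parameter, since for \<open>\<Delta> \<subseteq> \<Gamma>\<close> the ideal of \<open>\<Delta>\<close> is also taken in
  the polynomial ring on the vertices of \<open>\<Gamma>\<close>.\<close>

definition sr_ideal :: "'k::field itself \<Rightarrow> 'v set \<Rightarrow> 'v set set \<Rightarrow> (('v \<Rightarrow>\<^sub>0 nat) \<Rightarrow>\<^sub>0 'k) set" where
  "sr_ideal k V \<Delta> = Idl\<^bsub>poly_ring k V\<^esub> {\<Prod>v\<in>\<sigma>. pvar k v | \<sigma>. \<sigma> \<subseteq> V \<and> \<sigma> \<notin> \<Delta>}"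

definition sr_ring :: "'k::field itself \<Rightarrow> 'v set set \<Rightarrow> (('v \<Rightarrow>\<^sub>0 nat) \<Rightarrow>\<^sub>0 'k) set ring" where
  "sr_ring k \<Delta> = poly_ring k (\<Union>\<Delta>) Quot sr_ideal k (\<Union>\<Delta>) \<Delta>"

definition sr_dim :: "'k::field itself \<Rightarrow> 'v set set \<Rightarrow> enat" where
  "sr_dim k \<Delta> = krull_dim (sr_ring k \<Delta>)"

text \<open>The depth of the Stanley--Reisner ring is its depth as a module over the polynomial ring,
  with respect to the ideal generated by the variables.\<close>

definition sr_depth :: "'k::field itself \<Rightarrow> 'v set set \<Rightarrow> enat" where
  "sr_depth k \<Delta> =
     (let R = poly_ring k (\<Union>\<Delta>) in
      depth R (irrelevant_ideal k (\<Union>\<Delta>)) (quotient_module R (carrier R) (sr_ideal k (\<Union>\<Delta>) \<Delta>)))"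

section \<open>Cohen--Macaulay complexes, relative complexes and extenders\<close>

definition cohen_macaulay :: "'k::field itself \<Rightarrow> 'v set set \<Rightarrow> bool" where
  "cohen_macaulay k \<Gamma> \<longleftrightarrow> sr_depth k \<Gamma> = sr_dim k \<Gamma>"

text \<open>For finitely generated graded modules over the polynomial ring on \<open>V\<close>.\<close>

definition cm_module ::
  "'k::field itself \<Rightarrow> 'v set \<Rightarrow> (('v \<Rightarrow>\<^sub>0 nat) \<Rightarrow>\<^sub>0 'k, 'b, 'n) module_scheme \<Rightarrow> bool" where
  "cm_module k V M \<longleftrightarrow>
     carrier M = {\<zero>\<^bsub>M\<^esub>} \<or>
     depth (poly_ring k V) (irrelevant_ideal k V) M = module_dim (poly_ring k V) M"

definition relative_cohen_macaulay :: "'k::field itself \<Rightarrow> 'v set set \<Rightarrow> 'v set set \<Rightarrow> bool" where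
  "relative_cohen_macaulay k \<Gamma> \<Delta> \<longleftrightarrow>
     cm_module k (\<Union>\<Gamma>)
       (quotient_module (poly_ring k (\<Union>\<Gamma>)) (sr_ideal k (\<Union>\<Gamma>) \<Delta>) (sr_ideal k (\<Union>\<Gamma>) \<Gamma>))"

text \<open>The vertices of \<open>\<Gamma>\<close> come from the same type as those of \<open>\<Delta>\<close>.  So \<open>\<Gamma>\<close> may
  have arbitrarily many new vertices as soon as \<open>'v\<close> is infinite.\<close>

definition cm_extender :: "'k::field itself \<Rightarrow> 'v set set \<Rightarrow> 'v set set \<Rightarrow> bool" where
  "cm_extender k \<Delta> \<Gamma> \<longleftrightarrow>
     simplicial_complex \<Gamma> \<and> \<Gamma> \<noteq> {} \<and> complex_dim \<Gamma> = complex_dim \<Delta> \<and> \<Delta> \<subseteq> \<Gamma> \<and>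
     cohen_macaulay k \<Gamma> \<and> relative_cohen_macaulay k \<Gamma> \<Delta>"

end

theory Submission
  imports "HOL-Computational_Algebra.Polynomial" Defs
begin

text \<open>Let \<open>\<Gamma>\<close> be a Cohen--Macaulay extender of \<open>\<Delta>\<close>, let \<open>S\<close> be the polynomial ring on the vertices of
  \<open>\<Gamma>\<close>, \<open>m\<close> the ideal generated by the variables, and \<open>I \<subseteq> J\<close> the ideals of \<open>\<Gamma>\<close> and \<open>\<Delta>\<close> in \<open>S\<close>.
  The sequence \<open>0 \<rightarrow> J/I \<rightarrow> S/I \<rightarrow> S/J \<rightarrow> 0\<close> is exact, so the depth of \<open>S/J\<close> is at least
  \<open>min (depth (J/I) - 1) (depth (S/I))\<close> (\<open>depth_lemma\<close>).  Here \<open>depth (S/I) = dim (S/I)\<close>, which is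
  at least \<open>dim (S/J)\<close>.  If \<open>J/I \<noteq> 0\<close>, its depth is its dimension, and
  \<open>dim (J/I) \<ge> depth (S/I)\<close>: an associated prime of \<open>J/I\<close> is one of \<open>S/I\<close>, and the dimension of
  \<open>S/P\<close> is at least the depth of \<open>S/I\<close> for every associated prime \<open>P \<subseteq> m\<close> of \<open>S/I\<close>
  (\<open>prime_chain_from_depth\<close>).  So the depth of \<open>S/J\<close>, hence that of the Stanley--Reisner ring of
  \<open>\<Delta>\<close>, is at least its dimension minus one, contrary to the hypothesis.

  All modules that occur are quotients \<open>M/N\<close> of ideals \<open>N \<subseteq> M\<close> of \<open>S\<close>.  Dividing by \<open>f\<close> replaces
  \<open>N\<close> by \<open>N + f M\<close>, and depth is handled through sequences alone, with no homological algebra.  The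
  key is that the depth drops by exactly one on dividing by an arbitrary regular element
  (\<open>depth_ge_exchange\<close>).  It rests on the symmetry between two regular elements expressed by
  \<open>no_socle_exchange\<close> and on finding one element that is regular on several modules
  at once (\<open>common_regular_element\<close>), which needs that \<open>S\<close> is Noetherian (\<open>noetherian_polys\<close>).

  On the combinatorial side, an ideal of a complex consists of the polynomials none of whose
  monomials is supported on a face (\<open>sr_ideal_eq_face_ideal\<close>).  From this one sees that \<open>S/I\<close> has
  no elements that vanish after localising at \<open>m\<close> (\<open>face_ideal_saturated\<close>), and that setting the
  variables outside \<open>\<Delta>\<close> to zero carries regular sequences on \<open>S/J\<close> to regular sequences over the
  polynomial ring on the vertices of \<open>\<Delta>\<close> (\<open>depth_ge_image\<close>).\<close>

section \<open>Ideals, regular elements and prime avoidance\<close>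

text \<open>Multiplication by \<open>f\<close> is injective on \<open>M/N\<close>.\<close>

definition regular_on :: "'a::comm_ring_1 \<Rightarrow> 'a set \<Rightarrow> 'a set \<Rightarrow> bool" where
  "regular_on f M N \<longleftrightarrow> (\<forall>x\<in>M. f * x \<in> N \<longrightarrow> x \<in> N)"

definition add_multiple :: "'a::comm_ring_1 set \<Rightarrow> 'a \<Rightarrow> 'a set \<Rightarrow> 'a set" where
  "add_multiple N f M = {n + f * x | n x. n \<in> N \<and> x \<in> M}"

text \<open>There is a sequence of length \<open>g\<close> in \<open>m\<close> each of whose members is regular on \<open>M/N\<close> modulo its
  predecessors.  The quotient by the whole sequence may be zero: then the zero module
  has infinite depth, which keeps the exchange and depth lemmas free of case distinctions.
  For \<open>M = S\<close> and \<open>N\<close> inside a proper ideal \<open>m\<close> the difference disappears (\<open>depth_ge_le_depth\<close>).\<close>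

fun depth_ge :: "'a::comm_ring_1 set \<Rightarrow> nat \<Rightarrow> 'a set \<Rightarrow> 'a set \<Rightarrow> bool" where
  "depth_ge m 0 M N \<longleftrightarrow> True"
| "depth_ge m (Suc g) M N \<longleftrightarrow>
     (\<exists>f\<in>m. regular_on f M N \<and> depth_ge m g M (add_multiple N f M))"

text \<open>No nonzero element of \<open>M/N\<close> is killed by \<open>m\<close>.  Over a Noetherian ring this is the same as depth at
  least one, but unlike the latter it is stated without choosing a regular element.\<close>

definition no_socle :: "'a::comm_ring_1 set \<Rightarrow> 'a set \<Rightarrow> 'a set \<Rightarrow> bool" where
  "no_socle m M N \<longleftrightarrow> (\<forall>x\<in>M. (\<forall>r\<in>m. r * x \<in> N) \<longrightarrow> x \<in> N)"

text \<open>The form of the ascending chain condition used below: every sequence in \<open>S\<close> reaches a term that lies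
  in the ideal generated by the earlier ones.  This form passes to images under ring homomorphisms
  at once.\<close>

definition noetherian_set :: "'a::comm_ring_1 set \<Rightarrow> bool" where
  "noetherian_set S \<longleftrightarrow>
     (\<forall>a :: nat \<Rightarrow> 'a. range a \<subseteq> S \<longrightarrow> (\<exists>n r. range r \<subseteq> S \<and> a n = (\<Sum>i<n. r i * a i)))"

lemma add_multipleI: "n \<in> N \<Longrightarrow> x \<in> M \<Longrightarrow> n + f * x \<in> add_multiple N f M"
  unfolding add_multiple_def by blast

text \<open>The polynomial ring on a finite set of variables is a subset of the type of all polynomials, so
  rings are taken as subsets of a commutative ring type, with the operations of the type.\<close>

locale subring_set =
  fixes S :: "'a::comm_ring_1 set"
  assumes one_closed [simp, intro]: "1 \<in> S"
    and diff_closed [simp, intro]: "x \<in> S \<Longrightarrow> y \<in> S \<Longrightarrow> x - y \<in> S"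
    and mult_closed [simp, intro]: "x \<in> S \<Longrightarrow> y \<in> S \<Longrightarrow> x * y \<in> S"
begin

lemma zero_closed [simp, intro]: "0 \<in> S"
  using diff_closed[OF one_closed one_closed] by simp

lemma uminus_closed [simp, intro]: "x \<in> S \<Longrightarrow> - x \<in> S"
  using diff_closed[OF zero_closed] by fastforce

lemma add_closed [simp, intro]: "x \<in> S \<Longrightarrow> y \<in> S \<Longrightarrow> x + y \<in> S"
  using diff_closed[OF _ uminus_closed] by fastforce

lemma power_closed [simp, intro]: "x \<in> S \<Longrightarrow> x ^ n \<in> S"
  by (induction n) auto

lemma sum_closed [intro]: "(\<And>i. i \<in> I \<Longrightarrow> f i \<in> S) \<Longrightarrow> sum f I \<in> S"
  by (induction I rule: infinite_finite_induct) auto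

definition ideal_in :: "'a set \<Rightarrow> bool" where
  "ideal_in I \<longleftrightarrow> I \<subseteq> S \<and> 0 \<in> I \<and> (\<forall>x\<in>I. \<forall>y\<in>I. x + y \<in> I) \<and> (\<forall>r\<in>S. \<forall>x\<in>I. r * x \<in> I)"

lemma ideal_inI:
  assumes "\<And>x. x \<in> I \<Longrightarrow> x \<in> S" "0 \<in> I" "\<And>x y. x \<in> I \<Longrightarrow> y \<in> I \<Longrightarrow> x + y \<in> I"
    "\<And>r x. r \<in> S \<Longrightarrow> x \<in> I \<Longrightarrow> r * x \<in> I"
  shows "ideal_in I"
  using assms unfolding ideal_in_def by blast

lemma ideal_inD:
  assumes "ideal_in I"
  shows ideal_in_subset: "x \<in> I \<Longrightarrow> x \<in> S" and ideal_in_zero: "0 \<in> I"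
    and ideal_in_add: "x \<in> I \<Longrightarrow> y \<in> I \<Longrightarrow> x + y \<in> I"
    and ideal_in_mult: "r \<in> S \<Longrightarrow> x \<in> I \<Longrightarrow> r * x \<in> I"
  using assms unfolding ideal_in_def by auto

lemma ideal_in_uminus: "ideal_in I \<Longrightarrow> x \<in> I \<Longrightarrow> - x \<in> I"
  using ideal_in_mult[of I "- 1" x] by auto

lemma ideal_in_diff: "ideal_in I \<Longrightarrow> x \<in> I \<Longrightarrow> y \<in> I \<Longrightarrow> x - y \<in> I"
  using ideal_in_add[of I x "- y"] ideal_in_uminus by auto

lemma ideal_in_sum:
  "ideal_in I \<Longrightarrow> (\<And>i. i \<in> A \<Longrightarrow> f i \<in> I) \<Longrightarrow> sum f A \<in> I"
  by (induction A rule: infinite_finite_induct) (auto intro: ideal_in_zero ideal_in_add)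

lemma ideal_in_add_cancel: "ideal_in I \<Longrightarrow> x \<in> I \<Longrightarrow> x + y \<in> I \<longleftrightarrow> y \<in> I"
  using ideal_in_add ideal_in_diff[of I "x + y" x] by auto

lemma ideal_in_whole: "ideal_in S"
  by (rule ideal_inI) auto

lemma ideal_in_add_multiple:
  assumes N: "ideal_in N" and M: "ideal_in M" and f: "f \<in> S"
  shows "ideal_in (add_multiple N f M)"
proof (rule ideal_inI)
  show "x \<in> S" if "x \<in> add_multiple N f M" for x
    using that f ideal_in_subset[OF N] ideal_in_subset[OF M] by (auto simp: add_multiple_def)
  have "0 + f * 0 \<in> add_multiple N f M"
    unfolding add_multiple_def using ideal_in_zero[OF N] ideal_in_zero[OF M] by blast
  then show "0 \<in> add_multiple N f M" by simp
  show "x + y \<in> add_multiple N f M" if xy: "x \<in> add_multiple N f M" "y \<in> add_multiple N f M" for x y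
  proof -
    obtain n u k v where "x = n + f * u" "y = k + f * v" "n \<in> N" "k \<in> N" "u \<in> M" "v \<in> M"
      using xy unfolding add_multiple_def by blast
    then have "x + y = (n + k) + f * (u + v)" "n + k \<in> N" "u + v \<in> M"
      by (auto simp: algebra_simps ideal_in_add[OF N] ideal_in_add[OF M])
    then show ?thesis unfolding add_multiple_def by blast
  qed
  show "r * x \<in> add_multiple N f M" if rx: "r \<in> S" "x \<in> add_multiple N f M" for r x
  proof -
    obtain n u where "x = n + f * u" "n \<in> N" "u \<in> M"
      using rx unfolding add_multiple_def by blast
    then have "r * x = r * n + f * (r * u)" "r * n \<in> N" "r * u \<in> M"
      using rx by (auto simp: distrib_left mult.left_commute ideal_in_mult[OF N] ideal_in_mult[OF M])
    then show ?thesis unfolding add_multiple_def by blast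
  qed
qed

lemma add_multiple_subset:
  "ideal_in M \<Longrightarrow> N \<subseteq> M \<Longrightarrow> f \<in> S \<Longrightarrow> add_multiple N f M \<subseteq> M"
  by (auto simp: add_multiple_def intro!: ideal_in_add ideal_in_mult)

lemma subset_add_multiple: "ideal_in M \<Longrightarrow> N \<subseteq> add_multiple N f M"
  using add_multipleI[of _ N 0 M f] ideal_in_zero by auto

lemma multiple_in_add_multiple: "ideal_in N \<Longrightarrow> x \<in> M \<Longrightarrow> f * x \<in> add_multiple N f M"
  using add_multipleI[of 0 N x M f] ideal_in_zero by auto

lemma add_multiple_commute:
  "add_multiple (add_multiple N f M) h M = add_multiple (add_multiple N h M) f M"
proof -
  have *: "add_multiple (add_multiple N f M) h M \<subseteq> add_multiple (add_multiple N h M) f M" for f h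
  proof
    fix z assume "z \<in> add_multiple (add_multiple N f M) h M"
    then obtain n x y where "z = n + f * x + h * y" "n \<in> N" "x \<in> M" "y \<in> M"
      unfolding add_multiple_def by blast
    then have "z = (n + h * y) + f * x" "n + h * y \<in> add_multiple N h M"
      using add_multipleI[of n N y M h] by (auto simp: algebra_simps)
    then show "z \<in> add_multiple (add_multiple N h M) f M"
      using \<open>x \<in> M\<close> unfolding add_multiple_def[of "add_multiple N h M"] by blast
  qed
  show ?thesis using *[of f h] *[of h f] by blast
qed

definition prime_in :: "'a set \<Rightarrow> bool" where
  "prime_in P \<longleftrightarrow> ideal_in P \<and> 1 \<notin> P \<and> (\<forall>x\<in>S. \<forall>y\<in>S. x * y \<in> P \<longrightarrow> x \<in> P \<or> y \<in> P)"

lemma prime_in_ideal: "prime_in P \<Longrightarrow> ideal_in P"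
  by (simp add: prime_in_def)

lemma prime_inD: "prime_in P \<Longrightarrow> x * y \<in> P \<Longrightarrow> x \<in> S \<Longrightarrow> y \<in> S \<Longrightarrow> x \<in> P \<or> y \<in> P"
  by (auto simp: prime_in_def)

text \<open>A prime contains a product of ideals only if it contains a factor; the witness is a product of one
  nonmember from each ideal.\<close>

lemma common_nonmember_of_prime:
  assumes "prime_in P" "finite A" "ideal_in m" "\<not> m \<subseteq> P"
    "\<And>Q. Q \<in> A \<Longrightarrow> ideal_in Q \<and> \<not> Q \<subseteq> P"
  shows "\<exists>g\<in>m. g \<notin> P \<and> (\<forall>Q\<in>A. g \<in> Q)"
  using assms(2,5)
proof (induction A)
  case empty
  then show ?case using assms(4) by auto
next
  case (insert Q A)
  obtain g where g: "g \<in> m" "g \<notin> P" "\<forall>Q\<in>A. g \<in> Q"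
    using insert.IH insert.prems by auto
  obtain q where q: "q \<in> Q" "q \<notin> P" using insert.prems by auto
  have Q: "ideal_in Q" using insert.prems by auto
  have S: "g \<in> S" "q \<in> S" using g q ideal_in_subset assms(3) Q by auto
  have "q * g \<notin> P" using prime_inD[OF assms(1), of q g] g q S by auto
  moreover have "q * g \<in> m" using S g ideal_in_mult[OF assms(3)] by auto
  moreover have "q * g \<in> Q" using ideal_in_mult[OF Q S(1) q(1)] by (simp add: mult.commute)
  moreover have "q * g \<in> Q'" if "Q' \<in> A" for Q'
    using insert.prems[of Q'] that g S ideal_in_mult[of Q' q g] by auto
  ultimately show ?case by (intro bexI[of _ "q * g"]) auto
qed

text \<open>A prime contained in another member of \<open>A\<close> can be dropped.  Among pairwise incomparable
  primes, take \<open>f\<close> outside all but \<open>P\<close> and, if \<open>f \<in> P\<close>, add an element of \<open>m\<close> that lies in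
  all the others but not in \<open>P\<close>.\<close>

lemma prime_avoidance:
  assumes "finite A" "ideal_in m" "\<And>P. P \<in> A \<Longrightarrow> prime_in P \<and> \<not> m \<subseteq> P"
  shows "\<exists>f\<in>m. \<forall>P\<in>A. f \<notin> P"
  using assms(1,3)
proof (induction "card A" arbitrary: A rule: less_induct)
  case less
  show ?case
  proof (cases "\<exists>P\<in>A. \<exists>Q\<in>A. P \<noteq> Q \<and> Q \<subseteq> P")
    case True
    then obtain P Q where PQ: "P \<in> A" "Q \<in> A" "P \<noteq> Q" "Q \<subseteq> P" by blast
    have "card (A - {Q}) < card A" using PQ less.prems by (meson card_Diff1_less)
    then obtain f where "f \<in> m" "\<forall>P\<in>A - {Q}. f \<notin> P"
      using less.hyps[of "A - {Q}"] less.prems by auto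
    then show ?thesis using PQ by (intro bexI[of _ f]) blast+
  next
    case antichain: False
    show ?thesis
    proof (cases "A = {}")
      case True
      then show ?thesis using ideal_in_zero[OF assms(2)] by auto
    next
      case False
      then obtain P where P: "P \<in> A" by auto
      have "card (A - {P}) < card A" using P less.prems by (meson card_Diff1_less)
      then obtain f where f: "f \<in> m" "\<forall>Q\<in>A - {P}. f \<notin> Q"
        using less.hyps[of "A - {P}"] less.prems by auto
      have "\<exists>g\<in>m. g \<notin> P \<and> (\<forall>Q\<in>A - {P}. g \<in> Q)"
        using P antichain less.prems assms(2) prime_in_ideal
        by (intro common_nonmember_of_prime) blast+
      then obtain g where g: "g \<in> m" "g \<notin> P" "\<forall>Q\<in>A - {P}. g \<in> Q" by blast
      show ?thesis
      proof (cases "f \<in> P")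
        case True
        have "f + g \<notin> Q" if "Q \<in> A" for Q
        proof (cases "Q = P")
          case True
          then show ?thesis
            using ideal_in_add_cancel[of P f g] \<open>f \<in> P\<close> g P less.prems prime_in_ideal by auto
        next
          case False
          then show ?thesis
            using ideal_in_add_cancel[of Q g f] f g that less.prems prime_in_ideal
            by (auto simp: add.commute)
        qed
        then show ?thesis using f g ideal_in_add[OF assms(2)] by blast
      next
        case False
        then show ?thesis using f by blast
      qed
    qed
  qed
qed

text \<open>If \<open>f, h\<close> is a regular sequence, then \<open>f\<close> is regular modulo \<open>h\<close>: from \<open>f x = h y\<close> follows \<open>y = f z\<close>,
  since \<open>h\<close> is regular modulo \<open>f\<close>, and then \<open>f (x - h z) = 0\<close>.\<close>

lemma regular_on_swap:
  assumes M: "ideal_in M" and N: "ideal_in N" "N \<subseteq> M" and S: "f \<in> S" "h \<in> S"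
    and f: "regular_on f M N" and h: "regular_on h M (add_multiple N f M)"
  shows "regular_on f M (add_multiple N h M)"
  unfolding regular_on_def
proof (intro ballI impI)
  fix x assume x: "x \<in> M" "f * x \<in> add_multiple N h M"
  then obtain n y where y: "f * x = n + h * y" "n \<in> N" "y \<in> M" by (auto simp: add_multiple_def)
  have "h * y = - n + f * x" using y by simp
  then have "h * y \<in> add_multiple N f M"
    using x y ideal_in_uminus[OF N(1)] unfolding add_multiple_def by blast
  then have "y \<in> add_multiple N f M" using h y by (auto simp: regular_on_def)
  then obtain k z where z: "y = k + f * z" "k \<in> N" "z \<in> M" by (auto simp: add_multiple_def)
  have "f * (x - h * z) = n + h * k" using y z by (simp add: algebra_simps)
  also have "\<dots> \<in> N" using y z S by (intro ideal_in_add ideal_in_mult N)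
  finally have "x - h * z \<in> N"
    using f x z S ideal_in_diff[OF M] ideal_in_mult[OF M] by (auto simp: regular_on_def)
  then have "(x - h * z) + h * z \<in> add_multiple N h M" using z unfolding add_multiple_def by blast
  then show "x \<in> add_multiple N h M" by simp
qed

end

section \<open>Associated primes and common regular elements\<close>

locale noetherian_subring = subring_set +
  assumes noetherian: "noetherian_set S"
begin

lemma noetherianE:
  assumes "range a \<subseteq> S"
  obtains n :: nat and r where "range r \<subseteq> S" "a n = (\<Sum>i<n. r i * a i)"
proof -
  have "\<exists>n r. range r \<subseteq> S \<and> a n = (\<Sum>i<n. r i * a i)"
    using noetherian[unfolded noetherian_set_def, rule_format, OF assms] .
  then show ?thesis using that by (elim exE conjE)
qed

text \<open>A set without maximal member contains a strictly ascending sequence of ideals; elements witnessing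
  the strict inclusions form a sequence none of whose terms is generated by the earlier ones.\<close>

lemma exists_maximal_ideal:
  assumes "\<C> \<noteq> {}" "\<And>I. I \<in> \<C> \<Longrightarrow> ideal_in I"
  shows "\<exists>I\<in>\<C>. \<forall>J\<in>\<C>. I \<subseteq> J \<longrightarrow> J = I"
proof (rule ccontr)
  assume no_max: "\<not> ?thesis"
  have step: "\<exists>J. J \<in> \<C> \<and> I \<subset> J" if "I \<in> \<C>" for I
  proof -
    obtain J where "J \<in> \<C>" "I \<subseteq> J" "J \<noteq> I" using no_max \<open>I \<in> \<C>\<close> by meson
    then show ?thesis by blast
  qed
  obtain I0 where "I0 \<in> \<C>" using assms(1) by blast
  have "\<exists>C. \<forall>n::nat. C n \<in> \<C> \<and> C n \<subset> C (Suc n)"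
  proof (rule dependent_nat_choice[where P = "\<lambda>_ I. I \<in> \<C>" and Q = "\<lambda>_. (\<subset>)"])
    show "\<exists>I. I \<in> \<C>" using \<open>I0 \<in> \<C>\<close> ..
    show "\<exists>J. J \<in> \<C> \<and> I \<subset> J" if "I \<in> \<C>" for I using step[OF that] .
  qed
  then obtain C where "\<forall>n::nat. C n \<in> \<C> \<and> C n \<subset> C (Suc n)" ..
  then have C: "\<And>n::nat. C n \<in> \<C>" "\<And>n. C n \<subset> C (Suc n)" by simp_all
  have mono: "C i \<subseteq> C j" if "i \<le> j" for i j
    by (rule lift_Suc_mono_le[of C, OF psubset_imp_subset[OF C(2)] that])
  have "\<forall>n. \<exists>x. x \<in> C (Suc n) \<and> x \<notin> C n" using C(2) by blast
  then obtain a where a: "\<And>n. a n \<in> C (Suc n)" "\<And>n. a n \<notin> C n" by metis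
  have "a n \<in> S" for n using ideal_in_subset[OF assms(2)[OF C(1)] a(1)] .
  then have "range a \<subseteq> S" by auto
  then obtain n r where nr: "range r \<subseteq> S" "a n = (\<Sum>i<n. r i * a i)"
    by (rule noetherianE)
  have "(\<Sum>i<n. r i * a i) \<in> C n"
  proof (rule ideal_in_sum[OF assms(2)[OF C(1)]])
    fix i assume "i \<in> {..<n}"
    then have "a i \<in> C n" using a(1)[of i] mono[of "Suc i" n] by auto
    then show "r i * a i \<in> C n" using nr(1) by (intro ideal_in_mult[OF assms(2)[OF C(1)]]) auto
  qed
  then show False using nr(2) a(2)[of n] by simp
qed

definition ann_mod :: "'a set \<Rightarrow> 'a \<Rightarrow> 'a set" where
  "ann_mod N a = {r \<in> S. r * a \<in> N}"

lemma ideal_in_ann_mod: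
  assumes "ideal_in N" "a \<in> S" shows "ideal_in (ann_mod N a)"
proof (rule ideal_inI)
  show "x + y \<in> ann_mod N a" if "x \<in> ann_mod N a" "y \<in> ann_mod N a" for x y
    using that ideal_in_add[OF assms(1)] by (simp add: ann_mod_def distrib_right)
  show "r * x \<in> ann_mod N a" if "r \<in> S" "x \<in> ann_mod N a" for r x
    using that ideal_in_mult[OF assms(1)] by (simp add: ann_mod_def mult.assoc)
qed (use ideal_in_zero[OF assms(1)] in \<open>auto simp: ann_mod_def\<close>)

text \<open>These are the maximal associated primes of \<open>M/N\<close>; only they matter for zero divisors.\<close>

definition maximal_annihilators :: "'a set \<Rightarrow> 'a set \<Rightarrow> 'a set set" where
  "maximal_annihilators M N =
     {P \<in> ann_mod N ` (M - N). \<forall>Q \<in> ann_mod N ` (M - N). P \<subseteq> Q \<longrightarrow> Q = P}"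

lemma maximal_annihilatorE:
  assumes "P \<in> maximal_annihilators M N"
  obtains a where "a \<in> M" "a \<notin> N" "P = ann_mod N a"
    "\<forall>b\<in>M - N. P \<subseteq> ann_mod N b \<longrightarrow> ann_mod N b = P"
proof -
  from assms obtain a where a: "a \<in> M - N" "P = ann_mod N a"
    and max: "\<forall>Q \<in> ann_mod N ` (M - N). P \<subseteq> Q \<longrightarrow> Q = P"
    unfolding maximal_annihilators_def by fast
  show ?thesis using a max by (intro that[of a]) auto
qed

context
  fixes M N assumes M: "ideal_in M" and N: "ideal_in N" and NM: "N \<subseteq> M"
begin

lemma ann_mod_le_maximal:
  assumes "a \<in> M - N" shows "\<exists>P\<in>maximal_annihilators M N. ann_mod N a \<subseteq> P"
proof -
  define \<C> where "\<C> = {ann_mod N b | b. b \<in> M - N \<and> ann_mod N a \<subseteq> ann_mod N b}"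
  have "\<exists>I\<in>\<C>. \<forall>J\<in>\<C>. I \<subseteq> J \<longrightarrow> J = I"
    by (rule exists_maximal_ideal)
      (use assms in \<open>auto simp: \<C>_def intro!: ideal_in_ann_mod N ideal_in_subset[OF M]\<close>)
  then obtain P where P: "P \<in> \<C>" "\<forall>J\<in>\<C>. P \<subseteq> J \<longrightarrow> J = P" by blast
  have "P \<in> maximal_annihilators M N" using P unfolding maximal_annihilators_def \<C>_def by blast
  then show ?thesis using P(1) unfolding \<C>_def by blast
qed

text \<open>If \<open>x y\<close> kills \<open>a\<close> but \<open>y\<close> does not, then \<open>y a\<close> has an annihilator that contains that of \<open>a\<close>, hence equals it by
  maximality, and \<open>x\<close> lies in it.\<close>

lemma maximal_annihilator_prime:
  assumes "P \<in> maximal_annihilators M N" shows "prime_in P"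
proof -
  obtain a where a: "a \<in> M" "a \<notin> N" "P = ann_mod N a"
    and max: "\<forall>b\<in>M - N. P \<subseteq> ann_mod N b \<longrightarrow> ann_mod N b = P"
    using assms by (rule maximal_annihilatorE)
  have aS: "a \<in> S" using a M ideal_in_subset by blast
  have "x \<in> P \<or> y \<in> P" if xy: "x \<in> S" "y \<in> S" "x * y \<in> P" for x y
  proof (cases "y \<in> P")
    case False
    then have ya: "y * a \<notin> N" "y * a \<in> M" using a xy ideal_in_mult[OF M] by (auto simp: ann_mod_def)
    have "P \<subseteq> ann_mod N (y * a)"
      using a xy ideal_in_mult[OF N] by (auto simp: ann_mod_def mult.left_commute[of _ y a])
    then have "ann_mod N (y * a) = P" using max ya by blast
    moreover have "x \<in> ann_mod N (y * a)" using xy a by (simp add: ann_mod_def mult.assoc)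
    ultimately show ?thesis by simp
  qed auto
  moreover have "1 \<notin> P" using a by (simp add: ann_mod_def)
  ultimately show ?thesis
    using ideal_in_ann_mod[OF N aS] a by (auto simp: prime_in_def)
qed

text \<open>In an infinite family \<open>P n = ann (a n)\<close> some \<open>a n\<close> is a combination of earlier \<open>a i\<close>, so that
  \<open>P n\<close> contains the intersection of the earlier \<open>P i\<close>; being prime it contains one of them, against
  maximality.\<close>

lemma finite_maximal_annihilators: "finite (maximal_annihilators M N)"
proof (rule ccontr)
  assume "infinite (maximal_annihilators M N)"
  then obtain P :: "nat \<Rightarrow> 'a set" where P: "inj P" "range P \<subseteq> maximal_annihilators M N"
    using infinite_countable_subset by blast
  have "\<exists>a. \<forall>n. a n \<in> M - N \<and> P n = ann_mod N (a n)"
    using P(2) unfolding maximal_annihilators_def by (intro choice) blast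
  then obtain a where a: "\<And>n. a n \<in> M - N" "\<And>n. P n = ann_mod N (a n)" by blast
  have "range a \<subseteq> S" using a(1) ideal_in_subset[OF M] by auto
  then obtain n r where nr: "range r \<subseteq> S" "a n = (\<Sum>i<n. r i * a i)"
    by (rule noetherianE)
  have prime: "prime_in (P i)" for i using P(2) maximal_annihilator_prime by blast
  have not_sub: "\<not> P i \<subseteq> P n" if "i < n" for i
  proof
    assume "P i \<subseteq> P n"
    moreover have "P n \<in> ann_mod N ` (M - N)" using a by blast
    ultimately have "P n = P i" using P(2) unfolding maximal_annihilators_def by blast
    then show False using injD[OF P(1), of n i] that by simp
  qed
  have "\<exists>g\<in>S. g \<notin> P n \<and> (\<forall>Q\<in>P ` {..<n}. g \<in> Q)"
    using prime not_sub prime_in_ideal prime[of n] ideal_in_whole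
    by (intro common_nonmember_of_prime) (auto simp: prime_in_def)
  then obtain g where g: "g \<in> S" "g \<notin> P n" "\<And>i. i < n \<Longrightarrow> g \<in> P i" by auto
  have "g * a n = (\<Sum>i<n. r i * (g * a i))" by (simp add: nr(2) sum_distrib_left algebra_simps)
  also have "\<dots> \<in> N"
  proof (rule ideal_in_sum[OF N])
    fix i assume "i \<in> {..<n}"
    then show "r i * (g * a i) \<in> N" using g(3)[of i] a(2)[of i] nr(1)
      by (auto intro!: ideal_in_mult[OF N] simp: ann_mod_def)
  qed
  finally show False using g a(2)[of n] by (simp add: ann_mod_def)
qed

lemma regular_on_iff_avoids:
  assumes "f \<in> S"
  shows "regular_on f M N \<longleftrightarrow> (\<forall>P\<in>maximal_annihilators M N. f \<notin> P)"
proof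
  assume "regular_on f M N"
  then show "\<forall>P\<in>maximal_annihilators M N. f \<notin> P"
    unfolding regular_on_def by (auto simp: ann_mod_def elim!: maximal_annihilatorE)
next
  assume *: "\<forall>P\<in>maximal_annihilators M N. f \<notin> P"
  show "regular_on f M N" unfolding regular_on_def
  proof (intro ballI impI, rule ccontr)
    fix x assume x: "x \<in> M" "f * x \<in> N" "x \<notin> N"
    then have "f \<in> ann_mod N x" using assms by (simp add: ann_mod_def)
    moreover obtain P where "P \<in> maximal_annihilators M N" "ann_mod N x \<subseteq> P"
      using ann_mod_le_maximal[of x] x by blast
    ultimately show False using * by blast
  qed
qed

lemma no_socle_maximal_annihilator:
  assumes "no_socle m M N" "P \<in> maximal_annihilators M N" shows "\<not> m \<subseteq> P"
proof
  assume "m \<subseteq> P"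
  obtain a where "a \<in> M" "a \<notin> N" "P = ann_mod N a"
    using assms(2) by (rule maximal_annihilatorE)
  then show False using assms(1) \<open>m \<subseteq> P\<close> unfolding no_socle_def ann_mod_def by blast
qed

end

text \<open>The zero divisors on \<open>M/N\<close> are the elements of the finitely many maximal annihilators, and \<open>m\<close> is
  contained in none of those because it kills no nonzero element.  Prime avoidance applies to all the modules at
  once.\<close>

lemma common_regular_element:
  assumes m: "ideal_in m" and "finite \<M>"
    and \<M>: "\<And>M N. (M, N) \<in> \<M> \<Longrightarrow> ideal_in M \<and> ideal_in N \<and> N \<subseteq> M \<and> no_socle m M N"
  shows "\<exists>f\<in>m. \<forall>(M, N)\<in>\<M>. regular_on f M N"
proof -
  define A where "A = (\<Union>(M, N)\<in>\<M>. maximal_annihilators M N)"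
  have "finite A" unfolding A_def
    by (rule finite_UN_I[OF assms(2)]) (use \<M> in \<open>auto intro!: finite_maximal_annihilators\<close>)
  moreover have "prime_in P \<and> \<not> m \<subseteq> P" if "P \<in> A" for P
  proof -
    obtain M N where MN: "(M, N) \<in> \<M>" "P \<in> maximal_annihilators M N"
      using \<open>P \<in> A\<close> by (auto simp: A_def)
    then show ?thesis using \<M>[OF MN(1)] maximal_annihilator_prime[of M N P]
      no_socle_maximal_annihilator[of M N m P] by blast
  qed
  ultimately obtain f where f: "f \<in> m" "\<forall>P\<in>A. f \<notin> P" using prime_avoidance[OF _ m] by blast
  have "regular_on f M N" if "(M, N) \<in> \<M>" for M N
  proof -
    have "\<forall>P\<in>maximal_annihilators M N. f \<notin> P" using f that by (auto simp: A_def)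
    then show ?thesis
      using regular_on_iff_avoids[of M N f] \<M>[OF that] ideal_in_subset[OF m f(1)] by blast
  qed
  then show ?thesis using f by blast
qed

section \<open>Exchange of regular elements and the depth lemma\<close>

lemma depth_ge_no_socle:
  assumes "depth_ge m (Suc g) M N" shows "no_socle m M N"
  using assms by (auto simp: regular_on_def no_socle_def)

text \<open>If \<open>m\<close> kills \<open>x\<close> modulo \<open>h\<close>, write \<open>f x = h y\<close>.  Then \<open>m\<close> kills \<open>y\<close> modulo \<open>f\<close>: for \<open>r \<in> m\<close> with
  \<open>r x = h z\<close> one has \<open>h r y = f r x = f h z\<close>, and \<open>h\<close> cancels.  As there is no socle modulo \<open>f\<close>,
  \<open>y = f w\<close> for some \<open>w\<close>, and cancelling \<open>f\<close> in \<open>f x = h f w\<close> gives \<open>x = h w\<close>.\<close>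

lemma no_socle_exchange:
  assumes M: "ideal_in M" and N: "ideal_in N" "N \<subseteq> M" and m: "ideal_in m"
    and f: "f \<in> m" "regular_on f M N" and h: "h \<in> m" "regular_on h M N"
    and soc: "no_socle m M (add_multiple N f M)"
  shows "no_socle m M (add_multiple N h M)"
  unfolding no_socle_def
proof (intro ballI impI)
  fix x assume x: "x \<in> M" and soc_x: "\<forall>r\<in>m. r * x \<in> add_multiple N h M"
  have S: "f \<in> S" "h \<in> S" using f h ideal_in_subset[OF m] by auto
  obtain n y where y: "f * x = n + h * y" "n \<in> N" "y \<in> M"
    using soc_x f unfolding add_multiple_def by blast
  have "r * y \<in> add_multiple N f M" if r: "r \<in> m" for r
  proof -
    have rS: "r \<in> S" using r ideal_in_subset[OF m] by auto
    obtain k z where z: "r * x = k + h * z" "k \<in> N" "z \<in> M"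
      using soc_x r unfolding add_multiple_def by blast
    have "h * (r * y - f * z) = r * (h * y) - f * (h * z)" by (simp add: algebra_simps)
    also have "\<dots> = r * (f * x - n) - f * (r * x - k)" using y z by simp
    also have "\<dots> = f * k - r * n" by (simp add: algebra_simps)
    also have "\<dots> \<in> N" using y z S rS by (intro ideal_in_diff ideal_in_mult N)
    finally have "h * (r * y - f * z) \<in> N" .
    moreover have "r * y - f * z \<in> M" using y z S rS by (intro ideal_in_diff ideal_in_mult M)
    ultimately have "r * y - f * z \<in> N" using h(2) by (simp add: regular_on_def)
    then have "(r * y - f * z) + f * z \<in> add_multiple N f M"
      using z unfolding add_multiple_def by blast
    then show ?thesis by simp
  qed
  then have "y \<in> add_multiple N f M" using soc y by (auto simp: no_socle_def)
  then obtain k z where z: "y = k + f * z" "k \<in> N" "z \<in> M" unfolding add_multiple_def by blast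
  have "f * (x - h * z) = n + h * k" using y z by (simp add: algebra_simps)
  also have "\<dots> \<in> N" using y z S by (intro ideal_in_add ideal_in_mult N)
  finally have "f * (x - h * z) \<in> N" .
  moreover have "x - h * z \<in> M" using x z S by (intro ideal_in_diff ideal_in_mult M)
  ultimately have "x - h * z \<in> N" using f(2) by (simp add: regular_on_def)
  then have "(x - h * z) + h * z \<in> add_multiple N h M" using z unfolding add_multiple_def by blast
  then show "x \<in> add_multiple N h M" by simp
qed

text \<open>Any regular element can start a sequence of maximal length.  Let \<open>f1, \<dots>\<close> be the given sequence.
  By the exchange of socles some \<open>h \<in> m\<close> is regular on \<open>M/N\<close>, modulo \<open>f1\<close> and modulo \<open>f\<close>.
  Induction modulo \<open>f1\<close> replaces the second element by \<open>h\<close>; swapping, the sequence may start with \<open>h, f1\<close>;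
  induction modulo \<open>h\<close> replaces \<open>f1\<close> by \<open>f\<close>; and \<open>f\<close> may come before \<open>h\<close>, which is regular modulo \<open>f\<close>.\<close>

lemma depth_ge_exchange:
  assumes M: "ideal_in M" and m: "ideal_in m"
    and "ideal_in N" "N \<subseteq> M" "depth_ge m (Suc g) M N" "f \<in> m" "regular_on f M N"
  shows "depth_ge m g M (add_multiple N f M)"
  using assms(3-)
proof (induction g arbitrary: N f)
  case 0
  then show ?case by simp
next
  case (Suc g)
  note N = \<open>ideal_in N\<close> \<open>N \<subseteq> M\<close>
  have mS: "r \<in> S" if "r \<in> m" for r using that ideal_in_subset[OF m] by auto
  have add: "ideal_in (add_multiple N r M)" "add_multiple N r M \<subseteq> M" if "r \<in> m" for r
    using N M mS that by (simp_all add: ideal_in_add_multiple add_multiple_subset)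
  obtain f1 where f1: "f1 \<in> m" "regular_on f1 M N" "depth_ge m (Suc g) M (add_multiple N f1 M)"
    using Suc.prems(3) by (auto simp del: depth_ge.simps(2) simp: depth_ge.simps(2)[of m "Suc g"])
  have soc1: "no_socle m M (add_multiple N f1 M)" using f1(3) depth_ge_no_socle by blast
  have soc: "no_socle m M (add_multiple N f M)"
    using no_socle_exchange[OF M N m f1(1,2) Suc.prems(4,5) soc1] .
  have soc0: "no_socle m M N" using Suc.prems(3) depth_ge_no_socle by blast
  have "\<exists>h\<in>m. \<forall>(M, N)\<in>{(M, add_multiple N f1 M), (M, add_multiple N f M), (M, N)}. regular_on h M N"
    using add[OF f1(1)] add[OF Suc.prems(4)] N soc soc1 soc0 M
    by (intro common_regular_element m) auto
  then obtain h where h: "h \<in> m" "regular_on h M (add_multiple N f1 M)"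
    "regular_on h M (add_multiple N f M)" "regular_on h M N" by auto
  have "depth_ge m g M (add_multiple (add_multiple N h M) f1 M)"
    using Suc.IH[OF add[OF f1(1)] f1(3) h(1,2)] by (simp add: add_multiple_commute)
  moreover have "regular_on f1 M (add_multiple N h M)"
    using regular_on_swap[OF M N _ _ f1(2) h(2)] f1 h mS by auto
  ultimately have "depth_ge m (Suc g) M (add_multiple N h M)" using f1(1) by auto
  moreover have "regular_on f M (add_multiple N h M)"
    using regular_on_swap[OF M N _ _ Suc.prems(5) h(3)] Suc.prems(4) h mS by auto
  ultimately have "depth_ge m g M (add_multiple (add_multiple N f M) h M)"
    using Suc.IH[OF add[OF h(1)] _ Suc.prems(4)] by (simp add: add_multiple_commute)
  then show ?case using h by auto
qed

text \<open>The isomorphism of \<open>(A + B)/B\<close> with \<open>A/(A \<inter> B)\<close> transports regular sequences.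
  In the depth lemma it identifies the submodule left after dividing by \<open>f\<close>.\<close>

lemma depth_ge_second_iso:
  assumes "ideal_in A" "ideal_in B" "ideal_in m"
  shows "depth_ge m g {a + b | a b. a \<in> A \<and> b \<in> B} B \<longleftrightarrow> depth_ge m g A (A \<inter> B)"
  using assms(2)
proof (induction g arbitrary: B)
  case 0
  then show ?case by simp
next
  case (Suc g)
  define AB where "AB = {a + b | a b. a \<in> A \<and> b \<in> B}"
  have "regular_on f AB B \<longleftrightarrow> regular_on f A (A \<inter> B)"
    "add_multiple B f AB = add_multiple B f A"
    "A \<inter> add_multiple B f A = add_multiple (A \<inter> B) f A"
    "AB = {a + b | a b. a \<in> A \<and> b \<in> add_multiple B f A}"
    if "f \<in> m" for f
  proof -
    have fS: "f \<in> S" using that ideal_in_subset[OF assms(3)] by auto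
    show "regular_on f AB B \<longleftrightarrow> regular_on f A (A \<inter> B)"
    proof
      assume *: "regular_on f AB B"
      have "x \<in> AB" if "x \<in> A" for x
      proof -
        have "x + 0 \<in> AB" using that ideal_in_zero[OF \<open>ideal_in B\<close>] unfolding AB_def by blast
        then show ?thesis by simp
      qed
      then show "regular_on f A (A \<inter> B)" using * unfolding regular_on_def by auto
    next
      assume *: "regular_on f A (A \<inter> B)"
      show "regular_on f AB B" unfolding regular_on_def
      proof (intro ballI impI)
        fix x assume x: "x \<in> AB" "f * x \<in> B"
        then obtain a b where ab: "x = a + b" "a \<in> A" "b \<in> B" by (auto simp: AB_def)
        have "f * a = f * x - f * b" using ab by (simp add: algebra_simps)
        then have "f * a \<in> B" using x ab fS Suc.prems by (auto intro!: ideal_in_diff ideal_in_mult)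
        then have "a \<in> B" using * ab fS ideal_in_mult[OF assms(1)] unfolding regular_on_def by auto
        then show "x \<in> B" using ab Suc.prems ideal_in_add by auto
      qed
    qed
    show "add_multiple B f AB = add_multiple B f A"
    proof (intro subset_antisym subsetI)
      fix z assume "z \<in> add_multiple B f AB"
      then obtain n a b where z: "z = n + f * (a + b)" "n \<in> B" "a \<in> A" "b \<in> B"
        unfolding add_multiple_def AB_def by blast
      then have "z = (n + f * b) + f * a" by (simp add: algebra_simps)
      moreover have "n + f * b \<in> B" using z fS by (intro ideal_in_add ideal_in_mult Suc.prems)
      ultimately show "z \<in> add_multiple B f A" using z unfolding add_multiple_def by blast
    next
      fix z assume "z \<in> add_multiple B f A"
      then obtain n a where z: "z = n + f * a" "n \<in> B" "a \<in> A" unfolding add_multiple_def by blast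
      then have "z = n + f * (a + 0)" "a + 0 \<in> AB"
        using ideal_in_zero[OF Suc.prems] unfolding AB_def by (simp, blast)
      then show "z \<in> add_multiple B f AB" using z unfolding add_multiple_def by blast
    qed
    show "A \<inter> add_multiple B f A = add_multiple (A \<inter> B) f A"
    proof (intro subset_antisym subsetI)
      fix z assume z: "z \<in> A \<inter> add_multiple B f A"
      then obtain n a where na: "z = n + f * a" "n \<in> B" "a \<in> A" unfolding add_multiple_def by blast
      have "z - f * a \<in> A" using z na fS by (intro ideal_in_diff ideal_in_mult assms(1)) auto
      then have "n \<in> A" using na by simp
      then show "z \<in> add_multiple (A \<inter> B) f A" using na unfolding add_multiple_def by blast
    next
      fix z assume "z \<in> add_multiple (A \<inter> B) f A"
      then show "z \<in> A \<inter> add_multiple B f A"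
        using fS assms(1) unfolding add_multiple_def by (auto intro!: ideal_in_add ideal_in_mult)
    qed
    show "AB = {a + b | a b. a \<in> A \<and> b \<in> add_multiple B f A}"
    proof (intro subset_antisym subsetI)
      fix z assume "z \<in> AB"
      then show "z \<in> {a + b | a b. a \<in> A \<and> b \<in> add_multiple B f A}"
        using subset_add_multiple[OF assms(1), of B f] unfolding AB_def by blast
    next
      fix z assume "z \<in> {a + b | a b. a \<in> A \<and> b \<in> add_multiple B f A}"
      then obtain a n c where z: "z = a + (n + f * c)" "a \<in> A" "n \<in> B" "c \<in> A"
        unfolding add_multiple_def by blast
      then have "z = (a + f * c) + n" "a + f * c \<in> A"
        using fS assms(1) by (auto intro!: ideal_in_add ideal_in_mult)
      then show "z \<in> AB" using z unfolding AB_def by blast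
    qed
  qed
  note facts = this
  have "depth_ge m g AB (add_multiple B f AB) \<longleftrightarrow> depth_ge m g A (add_multiple (A \<inter> B) f A)"
    if "f \<in> m" for f
  proof -
    have "ideal_in (add_multiple B f A)"
      using that Suc.prems assms ideal_in_subset by (blast intro: ideal_in_add_multiple)
    from Suc.IH[OF this] show ?thesis using facts[OF that] by simp
  qed
  then show ?case using facts(1) unfolding AB_def by auto
qed

text \<open>The exact sequence is \<open>0 \<rightarrow> J/I \<rightarrow> K/I \<rightarrow> K/J \<rightarrow> 0\<close>.  If the depth of \<open>J/I\<close> is at least two and that of \<open>K/I\<close>
  at least one, then \<open>K/J\<close> has no socle, so a single \<open>f \<in> m\<close> is regular on all three modules.
  Modulo \<open>f\<close> the sequence stays exact, and the depths of the first two modules drop by exactly one.\<close>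

lemma depth_lemma:
  assumes K: "ideal_in K" and m: "ideal_in m"
    and "ideal_in I" "ideal_in J" "I \<subseteq> J" "J \<subseteq> K"
    and "depth_ge m (Suc g) J I" "depth_ge m g K I"
  shows "depth_ge m g K J"
  using assms(3-)
proof (induction g arbitrary: I J)
  case 0
  then show ?case by simp
next
  case (Suc g)
  note I = \<open>ideal_in I\<close> and J = \<open>ideal_in J\<close>
  have mS: "r \<in> S" if "r \<in> m" for r using that ideal_in_subset[OF m] by auto
  have socJ: "no_socle m J I" and socK: "no_socle m K I"
    using Suc.prems(5,6) depth_ge_no_socle by blast+
  have IK: "I \<subseteq> K" using Suc.prems by blast
  have socKJ: "no_socle m K J"
    unfolding no_socle_def
  proof (intro ballI impI)
    fix x assume x: "x \<in> K" and soc_x: "\<forall>r\<in>m. r * x \<in> J"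
    have "\<exists>f\<in>m. \<forall>(M, N)\<in>{(J, I), (K, I)}. regular_on f M N"
      using socJ socK I J K Suc.prems(3) IK by (intro common_regular_element m) auto
    then obtain f where f: "f \<in> m" "regular_on f J I" "regular_on f K I" by auto
    have "depth_ge m (Suc g) J (add_multiple I f J)"
      using depth_ge_exchange[OF J m I Suc.prems(3) Suc.prems(5) f(1,2)] .
    then have soc: "no_socle m J (add_multiple I f J)" by (rule depth_ge_no_socle)
    have "r * (f * x) \<in> add_multiple I f J" if "r \<in> m" for r
      using multiple_in_add_multiple[OF I, of "r * x" J f] soc_x that
      by (simp add: mult.left_commute)
    then have "f * x \<in> add_multiple I f J" using soc soc_x f(1) by (auto simp: no_socle_def)
    then obtain i j where ij: "f * x = i + f * j" "i \<in> I" "j \<in> J" unfolding add_multiple_def by blast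
    then have "f * (x - j) \<in> I" by (simp add: algebra_simps)
    then have "x - j \<in> I"
      using f(3) x ij Suc.prems(4) ideal_in_diff[OF K] by (auto simp: regular_on_def)
    then have "(x - j) + j \<in> J" using ij Suc.prems(3) by (intro ideal_in_add J) auto
    then show "x \<in> J" by simp
  qed
  have "\<exists>f\<in>m. \<forall>(M, N)\<in>{(J, I), (K, I), (K, J)}. regular_on f M N"
    using socJ socK socKJ I J K Suc.prems(3,4) IK by (intro common_regular_element m) auto
  then obtain f where f: "f \<in> m" "regular_on f J I" "regular_on f K I" "regular_on f K J" by auto
  \<comment> \<open>Modulo \<open>f\<close> the three modules are \<open>(J + f K)/I'\<close>, \<open>K/I'\<close> and \<open>K/(J + f K)\<close>; the first is
    \<open>J/(I + f J)\<close> because \<open>f\<close> is regular on \<open>K/J\<close>.\<close>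
  define I' where "I' = add_multiple I f K"
  have I': "ideal_in I'" "I' \<subseteq> K"
    unfolding I'_def using f mS I K IK by (simp_all add: ideal_in_add_multiple add_multiple_subset)
  have J': "ideal_in (add_multiple J f K)" "add_multiple J f K \<subseteq> K"
    using f mS J K Suc.prems by (simp_all add: ideal_in_add_multiple add_multiple_subset)
  have JI': "J \<inter> I' = add_multiple I f J"
  proof (intro subset_antisym subsetI)
    fix z assume z: "z \<in> J \<inter> I'"
    then obtain i x where ix: "z = i + f * x" "i \<in> I" "x \<in> K" unfolding I'_def add_multiple_def by blast
    have "f * x = z - i" using ix by simp
    also have "\<dots> \<in> J" using z ix Suc.prems(3) by (intro ideal_in_diff[OF J]) auto
    finally have "f * x \<in> J" .
    then have "x \<in> J" using f(4) ix by (auto simp: regular_on_def)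
    then show "z \<in> add_multiple I f J" using ix unfolding add_multiple_def by blast
  next
    fix z assume "z \<in> add_multiple I f J"
    moreover have "add_multiple I f J \<subseteq> J"
      by (rule add_multiple_subset[OF J Suc.prems(3) mS[OF f(1)]])
    moreover have "add_multiple I f J \<subseteq> I'"
      using Suc.prems(4) unfolding I'_def add_multiple_def by blast
    ultimately show "z \<in> J \<inter> I'" by blast
  qed
  have sumJI': "{a + b | a b. a \<in> J \<and> b \<in> I'} = add_multiple J f K"
  proof (intro subset_antisym subsetI)
    fix z assume "z \<in> {a + b | a b. a \<in> J \<and> b \<in> I'}"
    then obtain j i x where "z = j + (i + f * x)" "j \<in> J" "i \<in> I" "x \<in> K"
      unfolding I'_def add_multiple_def by blast
    then have "z = (j + i) + f * x" "j + i \<in> J" "x \<in> K"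
      using Suc.prems(3) ideal_in_add[OF J] by auto
    then show "z \<in> add_multiple J f K" unfolding add_multiple_def by blast
  next
    fix z assume "z \<in> add_multiple J f K"
    then obtain j x where "z = j + f * x" "j \<in> J" "x \<in> K" unfolding add_multiple_def by blast
    then show "z \<in> {a + b | a b. a \<in> J \<and> b \<in> I'}"
      using multiple_in_add_multiple[OF I, of x K f] unfolding I'_def by blast
  qed
  have "depth_ge m (Suc g) J (J \<inter> I')"
    unfolding JI' by (rule depth_ge_exchange[OF J m I Suc.prems(3) Suc.prems(5) f(1,2)])
  then have "depth_ge m (Suc g) (add_multiple J f K) I'"
    using depth_ge_second_iso[OF J I'(1) m, of "Suc g"] unfolding sumJI' by blast
  moreover have "depth_ge m g K I'"
    unfolding I'_def by (rule depth_ge_exchange[OF K m I IK Suc.prems(6) f(1,3)])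
  moreover have "I' \<subseteq> add_multiple J f K"
    using Suc.prems(3) unfolding I'_def add_multiple_def by blast
  ultimately have "depth_ge m g K (add_multiple J f K)"
    using Suc.IH[OF I'(1) J'(1) _ J'(2)] by blast
  then show ?case using f by auto
qed

section \<open>Depth is bounded by the dimension of a submodule\<close>

text \<open>The elements that become zero modulo \<open>N\<close> in the localisation at \<open>m\<close>.  Nakayama's lemma for
  elements of \<open>m\<close> holds in this localisation only, so the primes below are sought among the annihilators
  of elements outside this set; such annihilators lie in \<open>m\<close>.\<close>

definition vanishes_locally :: "'a set \<Rightarrow> 'a set \<Rightarrow> 'a set" where
  "vanishes_locally m N = {x. \<exists>s\<in>S - m. s * x \<in> N}"

context
  fixes m assumes m: "prime_in m"
begin

lemma vanishes_locally_cancel: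
  assumes "s \<in> S - m" "s * x \<in> vanishes_locally m N"
  shows "x \<in> vanishes_locally m N"
proof -
  obtain t where t: "t \<in> S - m" "t * (s * x) \<in> N"
    using assms(2) by (auto simp: vanishes_locally_def)
  have "t * s \<in> S - m" using t assms(1) prime_inD[OF m, of t s] by auto
  then show ?thesis
    using t unfolding vanishes_locally_def by (auto simp: mult.assoc intro!: bexI[of _ "t * s"])
qed

text \<open>The submodule \<open>U\<close> of \<open>S/N\<close> killed by \<open>P\<close> is nonzero at \<open>m\<close>.  If it became zero modulo \<open>f\<close>, then
  \<open>U = f U\<close> at \<open>m\<close>, because an element \<open>w\<close> with \<open>f w \<in> U\<close> lies in \<open>U\<close> again, and Nakayama's lemma
  would give \<open>U = 0\<close> at \<open>m\<close>.  In place of that lemma one follows \<open>a = f b\<^sub>1\<close>, \<open>b\<^sub>1 = f b\<^sub>2\<close>, and so on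
  until some \<open>b\<^sub>n\<close> is a combination of its predecessors, all of which are multiples of \<open>f b\<^sub>n\<close>:
  then \<open>(1 - f h) b\<^sub>n = 0\<close>.  The denominators outside \<open>m\<close> are carried along explicitly.\<close>

lemma krull_intersection_step:
  assumes N: "ideal_in N" and f: "f \<in> m" "regular_on f S N" and P: "P \<subseteq> S"
    and a: "a \<in> S" "\<forall>p\<in>P. p * a \<in> N" "a \<notin> vanishes_locally m N"
  shows "\<exists>b\<in>S. (\<forall>p\<in>P. p * b \<in> add_multiple N f S) \<and> b \<notin> vanishes_locally m (add_multiple N f S)"
proof (rule ccontr)
  assume contra: "\<not> ?thesis"
  have mid: "ideal_in m" using m prime_in_ideal by blast
  have fS: "f \<in> S" using f mid ideal_in_subset by blast
  define U where "U = {u \<in> S. \<forall>p\<in>P. p * u \<in> N}"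
  have "\<exists>s w. s \<in> S - m \<and> w \<in> U \<and> s * u - f * w \<in> N" if u: "u \<in> U" for u
  proof -
    have "\<forall>p\<in>P. p * u \<in> add_multiple N f S"
      using u subset_add_multiple[OF ideal_in_whole] by (auto simp: U_def)
    then have "u \<in> vanishes_locally m (add_multiple N f S)" using contra u by (auto simp: U_def)
    then obtain s n w where s: "s \<in> S - m" "s * u = n + f * w" "n \<in> N" "w \<in> S"
      unfolding vanishes_locally_def add_multiple_def by blast
    have "p * w \<in> N" if p: "p \<in> P" for p
    proof -
      have "f * (p * w) = p * (f * w)" by (simp add: algebra_simps)
      also have "\<dots> = p * (s * u - n)" using s by simp
      also have "\<dots> = s * (p * u) - p * n" by (simp add: algebra_simps)
      also have "\<dots> \<in> N"
        by (rule ideal_in_diff[OF N ideal_in_mult[OF N] ideal_in_mult[OF N]])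
          (use s p u P in \<open>auto simp: U_def\<close>)
      finally show ?thesis using f(2) p P s by (auto simp: regular_on_def)
    qed
    then show ?thesis using s by (intro exI[of _ s] exI[of _ w]) (auto simp: U_def)
  qed
  then obtain s w where sw: "\<And>u. u \<in> U \<Longrightarrow> s u \<in> S - m" "\<And>u. u \<in> U \<Longrightarrow> w u \<in> U"
    "\<And>u. u \<in> U \<Longrightarrow> s u * u - f * w u \<in> N" by metis
  define b where "b i = (w ^^ i) a" for i
  have bU: "b i \<in> U" for i by (induction i) (use a sw in \<open>auto simp: b_def U_def\<close>)
  then have bS: "b i \<in> S" for i by (auto simp: U_def)
  then have "range b \<subseteq> S" by auto
  then obtain n r where nr: "range r \<subseteq> S" "b n = (\<Sum>i<n. r i * b i)" by (rule noetherianE)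
  \<comment> \<open>Up to a factor outside \<open>m\<close>, each \<open>b (n - j)\<close> is the multiple \<open>f ^ j * b n\<close> modulo \<open>N\<close>.\<close>
  have pull: "\<exists>t\<in>S - m. t * b (n - j) - f ^ j * b n \<in> N" if "j \<le> n" for j
    using that
  proof (induction j)
    case 0
    then show ?case using m ideal_in_zero[OF N] by (intro bexI[of _ 1]) (auto simp: prime_in_def)
  next
    case (Suc j)
    then obtain t where t: "t \<in> S - m" "t * b (n - j) - f ^ j * b n \<in> N" by auto
    define c where "c = b (n - Suc j)"
    have wc: "w c = b (n - j)"
    proof -
      have "n - j = Suc (n - Suc j)" using Suc.prems by simp
      then show ?thesis by (simp add: c_def b_def)
    qed
    have c: "s c \<in> S - m" "s c * c - f * b (n - j) \<in> N" using sw[OF bU[of "n - Suc j"]] wc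
      by (auto simp: c_def)
    have "(t * s c) * c - f ^ Suc j * b n
        = t * (s c * c - f * b (n - j)) + f * (t * b (n - j) - f ^ j * b n)"
      by (simp add: algebra_simps)
    also have "\<dots> \<in> N" using t c fS by (intro ideal_in_add ideal_in_mult N) auto
    finally have "(t * s c) * c - f ^ Suc j * b n \<in> N" .
    moreover have "t * s c \<in> S - m" using t c prime_inD[OF m, of t "s c"] by auto
    ultimately show ?case unfolding c_def by blast
  qed
  have "\<exists>t\<in>S - m. \<exists>h\<in>S. t * (\<Sum>i<j. r i * b i) - f * h * b n \<in> N" if "j \<le> n" for j
    using that
  proof (induction j)
    case 0
    then show ?case using m ideal_in_zero[OF N]
      by (intro bexI[of _ 1] bexI[of _ 0]) (auto simp: prime_in_def)
  next
    case (Suc j)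
    then obtain t h where t: "t \<in> S - m" "h \<in> S" "t * (\<Sum>i<j. r i * b i) - f * h * b n \<in> N" by auto
    obtain t' where t': "t' \<in> S - m" "t' * b j - f ^ (n - j) * b n \<in> N"
      using pull[of "n - j"] Suc.prems by auto
    define e where "e = n - Suc j"
    have e: "f ^ (n - j) = f * f ^ e"
    proof -
      have "n - j = Suc e" using Suc.prems by (simp add: e_def)
      then show ?thesis by simp
    qed
    have rS: "r j \<in> S" using nr by auto
    have "(t' * t) * (\<Sum>i<Suc j. r i * b i) - f * (t' * h + t * r j * f ^ e) * b n
       = t' * (t * (\<Sum>i<j. r i * b i) - f * h * b n) + (t * r j) * (t' * b j - f ^ (n - j) * b n)"
      by (simp add: e algebra_simps)
    also have "\<dots> \<in> N"
      using t t' rS by (intro ideal_in_add[OF N] ideal_in_mult[OF N] mult_closed) auto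
    finally have "(t' * t) * (\<Sum>i<Suc j. r i * b i) - f * (t' * h + t * r j * f ^ e) * b n \<in> N" .
    moreover have "t' * t \<in> S - m" using t t' prime_inD[OF m, of t' t] by auto
    moreover have "t' * h + t * r j * f ^ e \<in> S" using t t' rS fS by auto
    ultimately show ?case by blast
  qed
  then obtain t h where t: "t \<in> S - m" "h \<in> S" "t * b n - f * h * b n \<in> N"
    using nr(2) by (metis order_refl)
  \<comment> \<open>\<open>t - f * h\<close> lies outside \<open>m\<close> and kills \<open>b n\<close> modulo \<open>N\<close>; as \<open>b 0 = a\<close> is locally a
    multiple of \<open>b n\<close>, it vanishes locally too.\<close>
  have "f * h \<in> m" using f t ideal_in_mult[OF mid, of h f] by (simp add: mult.commute)
  then have th: "t - f * h \<in> S - m"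
    using t fS ideal_in_add[OF mid, of "t - f * h" "f * h"] by auto
  obtain t0 where t0: "t0 \<in> S - m" "t0 * b 0 - f ^ n * b n \<in> N" using pull[of n] by auto
  have "((t - f * h) * t0) * b 0
      = (t - f * h) * (t0 * b 0 - f ^ n * b n) + f ^ n * (t * b n - f * h * b n)"
    by (simp add: algebra_simps)
  also have "\<dots> \<in> N" using t t0 th fS by (intro ideal_in_add ideal_in_mult N) auto
  finally have "((t - f * h) * t0) * b 0 \<in> N" .
  moreover have "(t - f * h) * t0 \<in> S - m" using th t0 prime_inD[OF m, of "t - f * h" t0] by auto
  ultimately have "a \<in> vanishes_locally m N" by (auto simp: vanishes_locally_def b_def)
  then show False using a by simp
qed

text \<open>Take an annihilator of a multiple of \<open>b\<close> that is maximal among the multiples that do not vanish at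
  \<open>m\<close>.  It is prime for the usual reason, except that a multiple \<open>y c\<close> may vanish at \<open>m\<close>; then some
  \<open>t c\<close> with \<open>t \<notin> m\<close> is killed by \<open>y\<close> and has the same annihilator as \<open>c\<close>.\<close>

lemma exists_local_associated_prime:
  assumes N: "ideal_in N" and b: "b \<in> S" "b \<notin> vanishes_locally m N"
  shows "\<exists>c\<in>S. c \<notin> vanishes_locally m N \<and> ann_mod N b \<subseteq> ann_mod N c \<and> prime_in (ann_mod N c)"
proof -
  define C where "C = {c * b | c. c \<in> S \<and> c * b \<notin> vanishes_locally m N}"
  have "1 * b \<in> C" unfolding C_def using b by fastforce
  have CS: "c \<in> S" if "c \<in> C" for c using that b by (auto simp: C_def)
  have "\<exists>I\<in>ann_mod N ` C. \<forall>J\<in>ann_mod N ` C. I \<subseteq> J \<longrightarrow> J = I"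
    by (rule exists_maximal_ideal) (use \<open>1 * b \<in> C\<close> CS in \<open>auto intro!: ideal_in_ann_mod N\<close>)
  then obtain c where c: "c \<in> C"
    and max: "\<And>d. d \<in> C \<Longrightarrow> ann_mod N c \<subseteq> ann_mod N d \<Longrightarrow> ann_mod N d = ann_mod N c" by blast
  obtain c' where c': "c = c' * b" "c' \<in> S" using c by (auto simp: C_def)
  have c_loc: "c \<notin> vanishes_locally m N" using c by (auto simp: C_def)
  have mult: "y * c \<in> C" if "y \<in> S" "y * c \<notin> vanishes_locally m N" for y
    using that c' unfolding C_def by (auto simp: mult.assoc[symmetric] intro!: exI[of _ "y * c'"])
  have mono: "ann_mod N c \<subseteq> ann_mod N (y * c)" if "y \<in> S" for y
    using that ideal_in_mult[OF N, of y] by (auto simp: ann_mod_def mult.left_commute[of _ y c])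
  have "x \<in> ann_mod N c \<or> y \<in> ann_mod N c"
    if xy: "x \<in> S" "y \<in> S" "x * y \<in> ann_mod N c" for x y
  proof (cases "y * c \<in> vanishes_locally m N")
    case False
    then have "ann_mod N (y * c) = ann_mod N c" using max mult mono xy by blast
    moreover have "x \<in> ann_mod N (y * c)" using xy by (auto simp: ann_mod_def mult.assoc)
    ultimately show ?thesis by simp
  next
    case True
    then obtain t where t: "t \<in> S - m" "t * (y * c) \<in> N" by (auto simp: vanishes_locally_def)
    have "t * c \<notin> vanishes_locally m N" using vanishes_locally_cancel[OF t(1)] c_loc by blast
    then have "ann_mod N (t * c) = ann_mod N c" using max mult mono t by blast
    moreover have "y \<in> ann_mod N (t * c)" using xy t by (auto simp: ann_mod_def mult.left_commute)
    ultimately show ?thesis by simp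
  qed
  moreover have "1 \<notin> ann_mod N c"
  proof
    assume "1 \<in> ann_mod N c"
    then have "c \<in> vanishes_locally m N"
      using m unfolding vanishes_locally_def by (auto simp: ann_mod_def prime_in_def intro!: bexI[of _ 1])
    then show False using c_loc by simp
  qed
  ultimately have "prime_in (ann_mod N c)"
    using ideal_in_ann_mod[OF N CS[OF c]] by (auto simp: prime_in_def)
  moreover have "ann_mod N b \<subseteq> ann_mod N c"
    using c' ideal_in_mult[OF N, of c'] by (auto simp: ann_mod_def mult.left_commute[of _ c' b])
  ultimately show ?thesis using c_loc CS[OF c] by blast
qed

text \<open>This is the inequality \<open>depth \<le> dim (S/P)\<close> for an associated prime \<open>P\<close>.  Dividing by a regular
  \<open>f \<in> m\<close>, the module still contains an element that is killed by \<open>P\<close> and nonzero at \<open>m\<close>; it is also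
  killed by \<open>f\<close>, which is not in \<open>P\<close>.  So an associated prime of the quotient strictly contains \<open>P\<close>.\<close>

lemma prime_chain_from_depth:
  assumes "ideal_in N" "a \<in> S" "a \<notin> vanishes_locally m N" "depth_ge m g S N"
  shows "\<exists>P :: nat \<Rightarrow> 'a set. (\<forall>i\<le>g. prime_in (P i)) \<and> (\<forall>i<g. P i \<subset> P (Suc i)) \<and> ann_mod N a \<subseteq> P 0"
  using assms
proof (induction g arbitrary: N a)
  case 0
  then obtain c where "ann_mod N a \<subseteq> ann_mod N c" "prime_in (ann_mod N c)"
    using exists_local_associated_prime by blast
  then show ?case by (intro exI[of _ "\<lambda>_. ann_mod N c"]) auto
next
  case (Suc g)
  obtain c where c: "c \<in> S" "c \<notin> vanishes_locally m N" "ann_mod N a \<subseteq> ann_mod N c" "prime_in (ann_mod N c)"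
    using exists_local_associated_prime Suc.prems by blast
  obtain f where f: "f \<in> m" "regular_on f S N" "depth_ge m g S (add_multiple N f S)"
    using Suc.prems(4) by auto
  have fS: "f \<in> S" using f ideal_in_subset[OF prime_in_ideal[OF m]] by auto
  have N': "ideal_in (add_multiple N f S)"
    using Suc.prems(1) fS by (intro ideal_in_add_multiple ideal_in_whole)
  have "\<exists>b\<in>S. (\<forall>p\<in>ann_mod N c. p * b \<in> add_multiple N f S) \<and> b \<notin> vanishes_locally m (add_multiple N f S)"
    by (rule krull_intersection_step[OF Suc.prems(1) f(1,2) _ c(1)]) (use c in \<open>auto simp: ann_mod_def\<close>)
  then obtain b where b: "b \<in> S" "\<forall>p\<in>ann_mod N c. p * b \<in> add_multiple N f S"
    "b \<notin> vanishes_locally m (add_multiple N f S)" by blast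
  obtain P where P: "\<forall>i\<le>g. prime_in (P i)" "\<forall>i<g. P i \<subset> P (Suc i)"
    "ann_mod (add_multiple N f S) b \<subseteq> P 0"
    using Suc.IH[OF N' b(1,3) f(3)] by blast
  have "ann_mod N c \<subseteq> P 0" using b(2) P(3) by (auto simp: ann_mod_def)
  moreover have "f \<in> P 0"
    using P(3) fS multiple_in_add_multiple[OF Suc.prems(1) b(1)] by (auto simp: ann_mod_def)
  moreover have "f \<notin> ann_mod N c"
  proof
    assume "f \<in> ann_mod N c"
    then have "c \<in> N" using f(2) c(1) by (auto simp: ann_mod_def regular_on_def)
    then have "1 \<in> ann_mod N c" by (simp add: ann_mod_def)
    then show False using c(4) by (simp add: prime_in_def)
  qed
  ultimately have sub: "ann_mod N c \<subset> P 0" by blast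
  define P' where "P' = case_nat (ann_mod N c) P"
  have "prime_in (P' i)" if "i \<le> Suc g" for i
    using that P(1) c(4) by (cases i) (auto simp: P'_def)
  moreover have "P' i \<subset> P' (Suc i)" if "i < Suc g" for i
    using that P(2) sub by (cases i) (auto simp: P'_def)
  moreover have "P' 0 = ann_mod N c" by (simp add: P'_def)
  ultimately show ?case using c(3) by (intro exI[of _ P']) auto
qed

end

end

section \<open>Polynomial rings in finitely many variables are Noetherian\<close>

definition polys_over :: "'a::comm_ring_1 set \<Rightarrow> 'a poly set" where
  "polys_over S = {p. \<forall>i. coeff p i \<in> S}"

lemma (in subring_set) subring_set_polys_over: "subring_set (polys_over S)"
proof
  show "p * q \<in> polys_over S" if "p \<in> polys_over S" "q \<in> polys_over S" for p q
    using that by (auto simp: polys_over_def coeff_mult intro!: sum_closed)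
qed (auto simp: polys_over_def)

lemma noetherian_set_image:
  fixes h :: "'a::comm_ring_1 \<Rightarrow> 'b::comm_ring_1"
  assumes "noetherian_set S"
    and add: "\<And>x y. h (x + y) = h x + h y" and mult: "\<And>x y. h (x * y) = h x * h y"
  shows "noetherian_set (h ` S)"
  unfolding noetherian_set_def
proof (intro allI impI)
  fix a :: "nat \<Rightarrow> 'b" assume "range a \<subseteq> h ` S"
  then have "\<forall>n. \<exists>b. b \<in> S \<and> a n = h b" by blast
  then obtain b where b: "\<And>n. b n \<in> S" "\<And>n. a n = h (b n)" by metis
  have "range b \<subseteq> S" using b by auto
  from assms(1)[unfolded noetherian_set_def, rule_format, OF this]
  obtain n r where r: "range r \<subseteq> S" "b n = (\<Sum>i<n. r i * b i)" by (elim exE conjE)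
  have "h 0 = 0" using add[of 0 0] by simp
  then have "h (\<Sum>i<k. r i * b i) = (\<Sum>i<k. h (r i) * h (b i))" for k
    by (induction k) (simp_all add: add mult)
  then have "a n = (\<Sum>i<n. (h \<circ> r) i * a i)" using r(2) b(2) by simp
  moreover have "range (h \<circ> r) \<subseteq> h ` S" using r(1) by auto
  ultimately show "\<exists>n r. range r \<subseteq> h ` S \<and> a n = (\<Sum>i<n. r i * a i)" by blast
qed

context subring_set
begin

fun span_upto :: "(nat \<Rightarrow> 'a) \<Rightarrow> nat \<Rightarrow> 'a set" where
  "span_upto a 0 = {0}"
| "span_upto a (Suc n) = add_multiple (span_upto a n) (a n) S"

lemma ideal_in_span_upto: "range a \<subseteq> S \<Longrightarrow> ideal_in (span_upto a n)"
  by (induction n)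
    (auto intro!: ideal_inI ideal_in_add_multiple ideal_in_whole simp: image_subset_iff)

lemma span_upto_sum:
  "x \<in> span_upto a n \<Longrightarrow> \<exists>r. range r \<subseteq> S \<and> x = (\<Sum>i<n. r i * a i)"
proof (induction n arbitrary: x)
  case 0
  then show ?case by (intro exI[of _ "\<lambda>_. 0"]) auto
next
  case (Suc n)
  then obtain y s where ys: "x = y + a n * s" "y \<in> span_upto a n" "s \<in> S"
    by (auto simp: add_multiple_def)
  then obtain r where r: "range r \<subseteq> S" "y = (\<Sum>i<n. r i * a i)" using Suc.IH by blast
  have "x = (\<Sum>i<Suc n. (r(n := s)) i * a i)" using ys r by (simp add: mult.commute)
  moreover have "range (r(n := s)) \<subseteq> S" using r ys by auto
  ultimately show ?case by blast
qed

end

text \<open>Hilbert's basis theorem.  In an ideal \<open>J\<close> that is not finitely generated, choose successively an element \<open>f n\<close>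
  of least degree outside the ideal \<open>I n\<close> generated by its predecessors.  Some leading coefficient
  is a combination of earlier ones, and subtracting the corresponding multiples of earlier
  \<open>f i\<close> leaves an element outside \<open>I n\<close> of smaller degree.\<close>

theorem (in noetherian_subring) noetherian_polys_over: "noetherian_set (polys_over S)"
proof (rule ccontr)
  interpret P: subring_set "polys_over S" by (rule subring_set_polys_over)
  assume "\<not> noetherian_set (polys_over S)"
  then obtain a :: "nat \<Rightarrow> 'a poly" where "\<not> (range a \<subseteq> polys_over S \<longrightarrow>
      (\<exists>n r. range r \<subseteq> polys_over S \<and> a n = (\<Sum>i<n. r i * a i)))"
    unfolding noetherian_set_def not_all ..
  then have aP: "range a \<subseteq> polys_over S"
    and bad: "\<And>n r. range r \<subseteq> polys_over S \<Longrightarrow> a n \<noteq> (\<Sum>i<n. r i * a i)" by auto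
  define A where "A = P.span_upto a"
  have A: "P.ideal_in (A n)" for n unfolding A_def using aP by (rule P.ideal_in_span_upto)
  have bad_A: "a n \<notin> A n" for n using P.span_upto_sum[of "a n" a n] bad unfolding A_def by blast
  have A_Suc: "A (Suc n) = add_multiple (A n) (a n) (polys_over S)" for n by (simp add: A_def)
  have A_mono: "A i \<subseteq> A j" if "i \<le> j" for i j
  proof (rule lift_Suc_mono_le[of A, OF _ that])
    show "A n \<subseteq> A (Suc n)" for n
      unfolding A_Suc by (rule P.subset_add_multiple[OF P.ideal_in_whole])
  qed
  have a_in: "a n \<in> A (Suc n)" for n
    using P.multiple_in_add_multiple[OF A P.one_closed, where f = "a n"] by (simp add: A_Suc)
  define J where "J = (\<Union>n. A n)"
  have J: "P.ideal_in J"
  proof (rule P.ideal_inI)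
    show "x + y \<in> J" if xy: "x \<in> J" "y \<in> J" for x y
    proof -
      obtain i j where "x \<in> A i" "y \<in> A j" using xy by (auto simp: J_def)
      then have "x \<in> A (max i j)" "y \<in> A (max i j)"
        using A_mono[of i "max i j"] A_mono[of j "max i j"] by auto
      then show ?thesis using P.ideal_in_add[OF A] unfolding J_def by blast
    qed
    show "x \<in> polys_over S" if "x \<in> J" for x
      using that P.ideal_in_subset[OF A] by (auto simp: J_def)
    show "0 \<in> J" using P.ideal_in_zero[OF A] by (auto simp: J_def)
    show "r * x \<in> J" if "r \<in> polys_over S" "x \<in> J" for r x
      using that P.ideal_in_mult[OF A] by (auto simp: J_def)
  qed
  define minimal where
    "minimal I f \<longleftrightarrow> f \<in> J - I \<and> (\<forall>g \<in> J - I. degree f \<le> degree g)" for I f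
  define good where "good I \<longleftrightarrow> P.ideal_in I \<and> (\<exists>n. I \<subseteq> A n)" for I
  have "\<exists>I'. good I' \<and> (\<exists>f. minimal I f \<and> I' = add_multiple I f (polys_over S))" if I_good: "good I" for I
  proof -
    obtain n where n: "I \<subseteq> A n" using I_good by (auto simp: good_def)
    then have "a n \<in> J - I" using bad_A[of n] a_in[of n] by (auto simp: J_def)
    then obtain f where f: "minimal I f"
      using arg_min_nat_lemma[of "\<lambda>f. f \<in> J - I" "a n" degree] unfolding minimal_def by blast
    then obtain k where k: "f \<in> A k" by (auto simp: minimal_def J_def)
    have fP: "f \<in> polys_over S" using P.ideal_in_subset[OF A k] .
    have "add_multiple I f (polys_over S) \<subseteq> A (max n k)"
    proof
      fix z assume "z \<in> add_multiple I f (polys_over S)"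
      then obtain i s where z: "z = i + f * s" "i \<in> I" "s \<in> polys_over S"
        by (auto simp: add_multiple_def)
      have "i \<in> A (max n k)" "f \<in> A (max n k)"
        using n k z A_mono[of n "max n k"] A_mono[of k "max n k"] by auto
      then have "i + s * f \<in> A (max n k)"
        using z by (intro P.ideal_in_add[OF A] P.ideal_in_mult[OF A])
      then show "z \<in> A (max n k)" using z by (simp add: mult.commute)
    qed
    moreover have "P.ideal_in (add_multiple I f (polys_over S))"
      using I_good fP by (intro P.ideal_in_add_multiple P.ideal_in_whole) (auto simp: good_def)
    ultimately show ?thesis using f unfolding good_def by blast
  qed
  note step = this
  have "\<exists>I. \<forall>n::nat. good (I n) \<and> (\<exists>f. minimal (I n) f \<and> I (Suc n) = add_multiple (I n) f (polys_over S))"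
  proof (rule dependent_nat_choice[where P = "\<lambda>_. good" and
        Q = "\<lambda>_ I I'. \<exists>f. minimal I f \<and> I' = add_multiple I f (polys_over S)"])
    have "good (A 0)" unfolding good_def using A by blast
    then show "\<exists>I. good I" ..
  qed (rule step)
  then obtain I where good_I: "\<And>n::nat. good (I n)"
    and "\<forall>n. \<exists>f. minimal (I n) f \<and> I (Suc n) = add_multiple (I n) f (polys_over S)" by meson
  then obtain f where min_f: "\<And>n. minimal (I n) (f n)"
    and I_Suc: "\<And>n. I (Suc n) = add_multiple (I n) (f n) (polys_over S)" by metis
  have I: "P.ideal_in (I n)" for n using good_I by (simp add: good_def)
  have I_mono: "I i \<subseteq> I j" if "i \<le> j" for i j
  proof (rule lift_Suc_mono_le[of I, OF _ that])
    show "I n \<subseteq> I (Suc n)" for n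
      unfolding I_Suc by (rule P.subset_add_multiple[OF P.ideal_in_whole])
  qed
  have f_in: "f n \<in> I (Suc n)" for n
    using P.multiple_in_add_multiple[OF I P.one_closed, where f = "f n"] by (simp add: I_Suc)
  have fJ: "f n \<in> J" for n using min_f[of n] by (simp add: minimal_def)
  then have fP: "f n \<in> polys_over S" for n using P.ideal_in_subset[OF J] by blast
  have "range (\<lambda>n. lead_coeff (f n)) \<subseteq> S" using fP by (auto simp: polys_over_def)
  then obtain n r where r: "range r \<subseteq> S" "lead_coeff (f n) = (\<Sum>i<n. r i * lead_coeff (f i))"
    by (rule noetherianE)
  have deg: "degree (f i) \<le> degree (f n)" if "i < n" for i
    using min_f[of i] min_f[of n] I_mono[of i n] that unfolding minimal_def by auto
  \<comment> \<open>A combination of the earlier \<open>f i\<close> with the same leading term as \<open>f n\<close>.\<close>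
  define s where "s = (\<Sum>i<n. monom (r i) (degree (f n) - degree (f i)) * f i)"
  have s_in: "s \<in> I n" unfolding s_def
  proof (rule P.ideal_in_sum[OF I])
    fix i assume i: "i \<in> {..<n}"
    have "monom (r i) d \<in> polys_over S" for d using r by (auto simp: polys_over_def)
    moreover have "f i \<in> I n" using f_in[of i] I_mono[of "Suc i" n] i by auto
    ultimately show "monom (r i) (degree (f n) - degree (f i)) * f i \<in> I n"
      by (rule P.ideal_in_mult[OF I])
  qed
  have "s \<in> J" using s_in good_I[of n] unfolding good_def J_def by blast
  then have "f n - s \<in> J" using fJ by (intro P.ideal_in_diff[OF J])
  moreover have "f n - s \<notin> I n"
  proof
    assume "f n - s \<in> I n"
    then have "(f n - s) + s \<in> I n" using s_in by (rule P.ideal_in_add[OF I])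
    then show False using min_f[of n] by (simp add: minimal_def)
  qed
  ultimately have le: "degree (f n) \<le> degree (f n - s)" using min_f[of n] by (simp add: minimal_def)
  have coeff_s: "coeff s (degree (f n)) = lead_coeff (f n)"
  proof -
    have "coeff s (degree (f n))
        = (\<Sum>i<n. coeff (monom (r i) (degree (f n) - degree (f i)) * f i) (degree (f n)))"
      by (simp add: s_def coeff_sum)
    also have "\<dots> = (\<Sum>i<n. r i * lead_coeff (f i))"
      using deg by (intro sum.cong refl) (simp add: coeff_monom_mult)
    finally show ?thesis using r(2) by simp
  qed
  have "degree s \<le> degree (f n)" unfolding s_def
  proof (rule degree_sum_le)
    fix i assume "i \<in> {..<n}"
    then show "degree (monom (r i) (degree (f n) - degree (f i)) * f i) \<le> degree (f n)"
      using deg[of i] degree_mult_le[of "monom (r i) (degree (f n) - degree (f i))" "f i"]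
        degree_monom_le[of "r i" "degree (f n) - degree (f i)"] by simp
  qed simp
  then have "degree (f n - s) \<le> degree (f n)" by (intro degree_diff_le) auto
  then have "degree (f n - s) = degree (f n)" using le by simp
  then have "lead_coeff (f n - s) = 0" using coeff_s by simp
  then have "f n - s = 0" by (simp only: leading_coeff_0_iff)
  then show False using \<open>f n - s \<notin> I n\<close> P.ideal_in_zero[OF I] by simp
qed

definition polys :: "'v set \<Rightarrow> (('v \<Rightarrow>\<^sub>0 nat) \<Rightarrow>\<^sub>0 'k::field) set" where
  "polys V = {p. \<forall>m\<in>Poly_Mapping.keys p. Poly_Mapping.keys m \<subseteq> V}"

lemma keys_add_monomial:
  "Poly_Mapping.keys (a + b :: 'v \<Rightarrow>\<^sub>0 nat) = Poly_Mapping.keys a \<union> Poly_Mapping.keys b"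
  by (auto simp: Poly_Mapping.in_keys_iff lookup_add)

lemma subring_set_polys: "subring_set (polys V :: (('v \<Rightarrow>\<^sub>0 nat) \<Rightarrow>\<^sub>0 'k::field) set)"
proof
  show "1 \<in> (polys V :: (('v \<Rightarrow>\<^sub>0 nat) \<Rightarrow>\<^sub>0 'k) set)" by (simp add: polys_def)
  fix p q :: "('v \<Rightarrow>\<^sub>0 nat) \<Rightarrow>\<^sub>0 'k" assume pq: "p \<in> polys V" "q \<in> polys V"
  show "p - q \<in> polys V" using pq keys_diff[of p q] by (fastforce simp: polys_def)
  show "p * q \<in> polys V" using pq keys_mult[of p q] by (fastforce simp: polys_def keys_add_monomial)
qed

lemma sum_of_monomials:
  "p = (\<Sum>m\<in>Poly_Mapping.keys p. Poly_Mapping.single m (Poly_Mapping.lookup p m))"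
proof (rule poly_mapping_eqI)
  fix k
  have "(\<Sum>m\<in>Poly_Mapping.keys p. Poly_Mapping.lookup (Poly_Mapping.single m (Poly_Mapping.lookup p m)) k)
     = (\<Sum>m\<in>Poly_Mapping.keys p. if m = k then Poly_Mapping.lookup p k else 0)"
    by (intro sum.cong refl) (auto simp: lookup_single)
  also have "\<dots> = Poly_Mapping.lookup p k"
    by (simp add: sum.delta' Poly_Mapping.in_keys_iff)
  finally show "Poly_Mapping.lookup p k = Poly_Mapping.lookup (\<Sum>m\<in>Poly_Mapping.keys p.
      Poly_Mapping.single m (Poly_Mapping.lookup p m)) k"
    by (simp add: lookup_sum)
qed

lemma pvar_power: "pvar k x ^ n = Poly_Mapping.single (Poly_Mapping.single x n) 1"
  by (induction n) (simp_all add: pvar_def mult_single flip: single_add)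

text \<open>Presents the ring on one more variable as a homomorphic image of univariate polynomials, so that it
  inherits the Noetherian property; surjectivity is checked on single monomials by splitting off the power
  of \<open>x\<close>.\<close>

lemma polys_insert:
  fixes k :: "'k::field itself" and x :: 'v
  shows "polys (insert x V) = (\<lambda>p. poly p (pvar k x)) ` polys_over (polys V)"
proof
  interpret V: subring_set "polys V :: (('v \<Rightarrow>\<^sub>0 nat) \<Rightarrow>\<^sub>0 'k) set" by (rule subring_set_polys)
  interpret xV: subring_set "polys (insert x V) :: (('v \<Rightarrow>\<^sub>0 nat) \<Rightarrow>\<^sub>0 'k) set" by (rule subring_set_polys)
  have sub: "polys V \<subseteq> (polys (insert x V) :: (('v \<Rightarrow>\<^sub>0 nat) \<Rightarrow>\<^sub>0 'k) set)" by (auto simp: polys_def)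
  have x: "pvar k x \<in> polys (insert x V)" by (simp add: polys_def pvar_def)
  show "(\<lambda>p. poly p (pvar k x)) ` polys_over (polys V) \<subseteq> polys (insert x V)"
    using sub x by (auto simp: polys_over_def poly_altdef intro!: xV.sum_closed)
  interpret P: subring_set "polys_over (polys V :: (('v \<Rightarrow>\<^sub>0 nat) \<Rightarrow>\<^sub>0 'k) set)"
    by (rule V.subring_set_polys_over)
  define T where "T = (\<lambda>p. poly p (pvar k x)) ` polys_over (polys V)"
  have T_sum: "sum f A \<in> T" if "\<And>i. i \<in> A \<Longrightarrow> f i \<in> T" for f :: "('v \<Rightarrow>\<^sub>0 nat) \<Rightarrow> _" and A
    using that
  proof (induction A rule: infinite_finite_induct)
    case (insert i A)
    then have "f i \<in> T" "sum f A \<in> T" by auto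
    then obtain p q where "f i = poly p (pvar k x)" "sum f A = poly q (pvar k x)"
      "p \<in> polys_over (polys V)" "q \<in> polys_over (polys V)" unfolding T_def by (elim imageE)
    then show ?case using insert.hyps P.add_closed
      by (auto simp: T_def simp flip: poly_add)
  qed (auto simp: T_def intro!: image_eqI[of _ _ 0])
  have T_single: "Poly_Mapping.single m c \<in> T" if m: "Poly_Mapping.keys m \<subseteq> insert x V"
    for m :: "'v \<Rightarrow>\<^sub>0 nat" and c :: 'k
  proof -
    define m' where "m' = Poly_Mapping.update x 0 m"
    have look: "Poly_Mapping.lookup m' y = (if y = x then 0 else Poly_Mapping.lookup m y)" for y
      by (simp add: m'_def update.rep_eq)
    have "m = m' + Poly_Mapping.single x (Poly_Mapping.lookup m x)"
      by (rule poly_mapping_eqI) (auto simp: look lookup_add lookup_single)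
    then have "Poly_Mapping.single m c
        = poly (monom (Poly_Mapping.single m' c) (Poly_Mapping.lookup m x)) (pvar k x)"
      by (simp add: poly_monom pvar_power mult_single)
    moreover have "Poly_Mapping.keys m' \<subseteq> V"
      using m by (auto simp: subset_iff Poly_Mapping.in_keys_iff look split: if_splits)
    then have "monom (Poly_Mapping.single m' c) (Poly_Mapping.lookup m x) \<in> polys_over (polys V)"
      by (auto simp: polys_over_def polys_def)
    ultimately show ?thesis unfolding T_def by blast
  qed
  show "polys (insert x V) \<subseteq> (\<lambda>p. poly p (pvar k x)) ` polys_over (polys V)"
  proof
    fix p :: "('v \<Rightarrow>\<^sub>0 nat) \<Rightarrow>\<^sub>0 'k" assume p: "p \<in> polys (insert x V)"
    show "p \<in> (\<lambda>p. poly p (pvar k x)) ` polys_over (polys V)"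
      unfolding T_def[symmetric] using p
      by (subst sum_of_monomials[of p]) (intro T_sum T_single, simp add: polys_def)
  qed
qed

lemma noetherian_polys:
  assumes "finite V"
  shows "noetherian_set (polys V :: (('v \<Rightarrow>\<^sub>0 nat) \<Rightarrow>\<^sub>0 'k::field) set)"
  using assms
proof (induction V)
  case empty
  show ?case unfolding noetherian_set_def
  proof (intro allI impI)
    fix a :: "nat \<Rightarrow> ('v \<Rightarrow>\<^sub>0 nat) \<Rightarrow>\<^sub>0 'k" assume a: "range a \<subseteq> polys {}"
    have const: "p = Poly_Mapping.single 0 (Poly_Mapping.lookup p 0)" if "p \<in> polys {}"
      for p :: "('v \<Rightarrow>\<^sub>0 nat) \<Rightarrow>\<^sub>0 'k"
    proof -
      have "Poly_Mapping.keys p \<subseteq> {0}" using that by (auto simp: polys_def)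
      then have "Poly_Mapping.lookup p k = 0" if "k \<noteq> 0" for k
        using that by (auto simp: Poly_Mapping.in_keys_iff)
      then show ?thesis by (intro poly_mapping_eqI) (auto simp: lookup_single when_def)
    qed
    define c d where "c = Poly_Mapping.lookup (a 0) 0" and "d = Poly_Mapping.lookup (a 1) 0"
    have c: "a 0 = Poly_Mapping.single 0 c" and d: "a 1 = Poly_Mapping.single 0 d"
      unfolding c_def d_def using a by (auto intro!: const)
    show "\<exists>n r. range r \<subseteq> polys {} \<and> a n = (\<Sum>i<n. r i * a i)"
    proof (cases "c = 0")
      case True
      then have "a 0 = (\<Sum>i<0. 0 * a i)" using c by simp
      moreover have "range (\<lambda>_::nat. 0 :: ('v \<Rightarrow>\<^sub>0 nat) \<Rightarrow>\<^sub>0 'k) \<subseteq> polys {}" by (auto simp: polys_def)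
      ultimately show ?thesis by (intro exI[of _ 0] exI[of _ "\<lambda>_. 0"]) simp
    next
      case False
      then have "a 1 = (\<Sum>i<1. Poly_Mapping.single 0 (d / c) * a i)" using c d by (simp add: mult_single)
      moreover have "range (\<lambda>_::nat. Poly_Mapping.single 0 (d / c) :: ('v \<Rightarrow>\<^sub>0 nat) \<Rightarrow>\<^sub>0 'k) \<subseteq> polys {}"
        by (auto simp: polys_def)
      ultimately show ?thesis by blast
    qed
  qed
next
  case (insert x V)
  interpret subring_set "polys V :: (('v \<Rightarrow>\<^sub>0 nat) \<Rightarrow>\<^sub>0 'k) set" by (rule subring_set_polys)
  interpret noetherian_subring "polys V :: (('v \<Rightarrow>\<^sub>0 nat) \<Rightarrow>\<^sub>0 'k) set"
    by unfold_locales (rule insert.IH)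
  show ?case
    unfolding polys_insert[of x V "TYPE('k)"]
    by (rule noetherian_set_image[OF noetherian_polys_over]) simp_all
qed

section \<open>Depth, dimension and regular sequences over a subring\<close>

definition ring_of :: "'a::comm_ring_1 set \<Rightarrow> 'a ring" where
  "ring_of S = \<lparr>carrier = S, mult = (*), one = 1, zero = 0, add = (+)\<rparr>"

lemma ring_of_simps [simp]:
  "carrier (ring_of S) = S" "x \<otimes>\<^bsub>ring_of S\<^esub> y = x * y" "\<one>\<^bsub>ring_of S\<^esub> = 1"
  "x \<oplus>\<^bsub>ring_of S\<^esub> y = x + y" "\<zero>\<^bsub>ring_of S\<^esub> = 0"
  by (simp_all add: ring_of_def)

lemma coset_ring_of: "I +>\<^bsub>ring_of S\<^esub> a = {i + a | i. i \<in> I}"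
  by (auto simp: a_r_coset_def r_coset_def ring_of_def)

text \<open>Turns the description of \<open>(r\<^sub>1, \<dots>, r\<^sub>k) M\<close> by one sum into a recursion on the length of the list.\<close>

lemma list_smult_snoc:
  assumes "abelian_monoid M" and rs: "\<And>r x. r \<in> set (rs @ [s]) \<Longrightarrow> x \<in> carrier M \<Longrightarrow> r \<odot>\<^bsub>M\<^esub> x \<in> carrier M"
  shows "list_smult (rs @ [s]) M = {y \<oplus>\<^bsub>M\<^esub> s \<odot>\<^bsub>M\<^esub> x | y x. y \<in> list_smult rs M \<and> x \<in> carrier M}"
proof -
  interpret abelian_monoid M by fact
  have split: "(\<Oplus>\<^bsub>M\<^esub>j\<in>{..<length (rs @ [s])}. (rs @ [s]) ! j \<odot>\<^bsub>M\<^esub> x j)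
      = (\<Oplus>\<^bsub>M\<^esub>j\<in>{..<length rs}. rs ! j \<odot>\<^bsub>M\<^esub> x j) \<oplus>\<^bsub>M\<^esub> s \<odot>\<^bsub>M\<^esub> x (length rs)"
    if x: "x \<in> {..<Suc (length rs)} \<rightarrow> carrier M" for x
  proof -
    have closed: "rs ! j \<odot>\<^bsub>M\<^esub> x j \<in> carrier M" if "j < length rs" for j
      using x that by (intro rs) auto
    have "s \<odot>\<^bsub>M\<^esub> x (length rs) \<in> carrier M" using x by (intro rs) auto
    then have "(\<Oplus>\<^bsub>M\<^esub>j\<in>insert (length rs) {..<length rs}. (rs @ [s]) ! j \<odot>\<^bsub>M\<^esub> x j)
       = s \<odot>\<^bsub>M\<^esub> x (length rs) \<oplus>\<^bsub>M\<^esub> (\<Oplus>\<^bsub>M\<^esub>j\<in>{..<length rs}. (rs @ [s]) ! j \<odot>\<^bsub>M\<^esub> x j)"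
      using closed by (subst finsum_insert) (auto simp: nth_append)
    also have "(\<Oplus>\<^bsub>M\<^esub>j\<in>{..<length rs}. (rs @ [s]) ! j \<odot>\<^bsub>M\<^esub> x j)
        = (\<Oplus>\<^bsub>M\<^esub>j\<in>{..<length rs}. rs ! j \<odot>\<^bsub>M\<^esub> x j)"
      using closed by (intro finsum_cong') (auto simp: nth_append)
    finally show ?thesis
      using closed \<open>s \<odot>\<^bsub>M\<^esub> x (length rs) \<in> carrier M\<close>
      by (simp add: lessThan_Suc a_comm finsum_closed Pi_iff)
  qed
  show ?thesis
  proof (intro subset_antisym subsetI)
    fix z assume "z \<in> list_smult (rs @ [s]) M"
    then obtain x where x: "x \<in> {..<Suc (length rs)} \<rightarrow> carrier M"
      "z = (\<Oplus>\<^bsub>M\<^esub>j\<in>{..<length (rs @ [s])}. (rs @ [s]) ! j \<odot>\<^bsub>M\<^esub> x j)"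
      unfolding list_smult_def by auto
    moreover have "(\<Oplus>\<^bsub>M\<^esub>j\<in>{..<length rs}. rs ! j \<odot>\<^bsub>M\<^esub> x j) \<in> list_smult rs M"
    proof -
      have "x \<in> {..<length rs} \<rightarrow> carrier M" using x(1) by auto
      then show ?thesis unfolding list_smult_def by blast
    qed
    moreover have "x (length rs) \<in> carrier M" using x(1) by auto
    ultimately show "z \<in> {y \<oplus>\<^bsub>M\<^esub> s \<odot>\<^bsub>M\<^esub> x | y x. y \<in> list_smult rs M \<and> x \<in> carrier M}"
      using split[OF x(1)] by blast
  next
    fix z assume "z \<in> {y \<oplus>\<^bsub>M\<^esub> s \<odot>\<^bsub>M\<^esub> x | y x. y \<in> list_smult rs M \<and> x \<in> carrier M}"
    then obtain x u where x: "x \<in> {..<length rs} \<rightarrow> carrier M" and u: "u \<in> carrier M"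
      and z: "z = (\<Oplus>\<^bsub>M\<^esub>j\<in>{..<length rs}. rs ! j \<odot>\<^bsub>M\<^esub> x j) \<oplus>\<^bsub>M\<^esub> s \<odot>\<^bsub>M\<^esub> u"
      unfolding list_smult_def by auto
    define x' where "x' = x(length rs := u)"
    have x': "x' \<in> {..<Suc (length rs)} \<rightarrow> carrier M"
      using x u by (auto simp: x'_def Pi_iff less_Suc_eq)
    have "(\<Oplus>\<^bsub>M\<^esub>j\<in>{..<length rs}. rs ! j \<odot>\<^bsub>M\<^esub> x' j) = (\<Oplus>\<^bsub>M\<^esub>j\<in>{..<length rs}. rs ! j \<odot>\<^bsub>M\<^esub> x j)"
      using x rs by (intro finsum_cong') (auto simp: x'_def Pi_iff)
    then have "z = (\<Oplus>\<^bsub>M\<^esub>j\<in>{..<length (rs @ [s])}. (rs @ [s]) ! j \<odot>\<^bsub>M\<^esub> x' j)"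
      using split[OF x'] z by (simp add: x'_def)
    then show "z \<in> list_smult (rs @ [s]) M" using x' unfolding list_smult_def by auto
  qed
qed

definition multiples_ideal :: "'a::comm_ring_1 set \<Rightarrow> 'a set \<Rightarrow> 'a list \<Rightarrow> 'a set" where
  "multiples_ideal M N rs = foldl (\<lambda>N f. add_multiple N f M) N rs"

lemma depth_ge_iff_list:
  "depth_ge m n M N \<longleftrightarrow> (\<exists>rs. length rs = n \<and> set rs \<subseteq> m \<and>
     (\<forall>i<n. regular_on (rs ! i) M (multiples_ideal M N (take i rs))))"
proof (induction n arbitrary: N)
  case 0
  then show ?case by simp
next
  case (Suc n)
  define weakly_regular where "weakly_regular N rs \<longleftrightarrow> set rs \<subseteq> m \<and>
    (\<forall>i<length rs. regular_on (rs ! i) M (multiples_ideal M N (take i rs)))" for N rs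
  have Cons: "weakly_regular N (f # fs) \<longleftrightarrow>
      f \<in> m \<and> regular_on f M N \<and> weakly_regular (add_multiple N f M) fs" for f fs
    by (auto simp: weakly_regular_def All_less_Suc2 multiples_ideal_def)
  have "depth_ge m n M N' \<longleftrightarrow> (\<exists>rs. length rs = n \<and> weakly_regular N' rs)" for N'
    unfolding Suc.IH weakly_regular_def by auto
  then have "depth_ge m (Suc n) M N \<longleftrightarrow> (\<exists>f fs. length fs = n \<and> weakly_regular N (f # fs))"
    unfolding depth_ge.simps Cons by blast
  also have "\<dots> \<longleftrightarrow> (\<exists>rs. length rs = Suc n \<and> weakly_regular N rs)"
    by (auto simp: length_Suc_conv)
  also have "\<dots> \<longleftrightarrow> (\<exists>rs. length rs = Suc n \<and> set rs \<subseteq> m \<and>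
     (\<forall>i<Suc n. regular_on (rs ! i) M (multiples_ideal M N (take i rs))))"
    unfolding weakly_regular_def by (intro ex_cong1 conj_cong refl) auto
  finally show ?case .
qed

lemma depth_ge_mono: "depth_ge m n M N \<Longrightarrow> l \<le> n \<Longrightarrow> depth_ge m l M N"
proof (induction l arbitrary: n N)
  case (Suc l)
  then show ?case by (cases n) auto
qed simp

context subring_set
begin

lemma cring_ring_of: "cring (ring_of S)"
proof (rule cringI)
  show "abelian_group (ring_of S)"
  proof (rule abelian_groupI)
    show "\<exists>y\<in>carrier (ring_of S). y \<oplus>\<^bsub>ring_of S\<^esub> x = \<zero>\<^bsub>ring_of S\<^esub>" if "x \<in> carrier (ring_of S)" for x
      using that by (intro bexI[of _ "- x"]) auto
  qed (auto simp: algebra_simps)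
  show "comm_monoid (ring_of S)"
    by (rule comm_monoidI) (auto simp: algebra_simps)
qed (auto simp: algebra_simps)

sublocale R: cring "ring_of S" by (rule cring_ring_of)

lemma ring_of_uminus: "x \<in> S \<Longrightarrow> \<ominus>\<^bsub>ring_of S\<^esub> x = - x"
  by (rule R.minus_equality) auto

lemma ideal_ring_of_iff: "ideal I (ring_of S) \<longleftrightarrow> ideal_in I"
proof
  assume "ideal I (ring_of S)"
  then interpret ideal I "ring_of S" .
  show "ideal_in I"
    using a_subset zero_closed a_closed I_l_closed by (intro ideal_inI) auto
next
  assume I: "ideal_in I"
  show "ideal I (ring_of S)"
  proof (rule idealI[OF R.ring_axioms])
    show "subgroup I (add_monoid (ring_of S))"
    proof (rule R.add.subgroupI)
      show "I \<noteq> {}" using ideal_in_zero[OF I] by blast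
      show "I \<subseteq> carrier (ring_of S)" using ideal_in_subset[OF I] by auto
      show "\<ominus>\<^bsub>ring_of S\<^esub> a \<in> I" if "a \<in> I" for a
        using that ring_of_uminus ideal_in_subset[OF I that] ideal_in_uminus[OF I that] by simp
    qed (use ideal_in_add[OF I] in auto)
    show "x \<otimes>\<^bsub>ring_of S\<^esub> a \<in> I" "a \<otimes>\<^bsub>ring_of S\<^esub> x \<in> I" if "a \<in> I" "x \<in> carrier (ring_of S)" for a x
      using ideal_in_mult[OF I, of x a] that by (simp_all add: mult.commute)
  qed
qed

lemma primeideal_ring_of_iff: "primeideal P (ring_of S) \<longleftrightarrow> prime_in P"
proof
  assume "primeideal P (ring_of S)"
  then interpret primeideal P "ring_of S" .
  have P: "ideal_in P" using ideal_axioms ideal_ring_of_iff by blast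
  have "1 \<notin> P"
  proof
    assume "1 \<in> P"
    then have "x \<in> P" if "x \<in> S" for x using ideal_in_mult[OF P that] by fastforce
    then show False using I_notcarr ideal_in_subset[OF P] by auto
  qed
  then show "prime_in P" using P I_prime by (auto simp: prime_in_def)
next
  assume P: "prime_in P"
  then have "S \<noteq> P" by (auto simp: prime_in_def)
  then show "primeideal P (ring_of S)"
    using P ideal_ring_of_iff by (intro primeidealI cring_ring_of) (auto simp: prime_in_def)
qed

lemma coset_eq_iff:
  assumes I: "ideal_in I" and xy: "x \<in> S" "y \<in> S"
  shows "I +>\<^bsub>ring_of S\<^esub> x = I +>\<^bsub>ring_of S\<^esub> y \<longleftrightarrow> x - y \<in> I"
proof
  assume eq: "I +>\<^bsub>ring_of S\<^esub> x = I +>\<^bsub>ring_of S\<^esub> y"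
  have "0 + x \<in> I +>\<^bsub>ring_of S\<^esub> x" unfolding coset_ring_of using ideal_in_zero[OF I] by blast
  then obtain i where "x = i + y" "i \<in> I" using eq unfolding coset_ring_of by auto
  then show "x - y \<in> I" by simp
next
  have sub: "I +>\<^bsub>ring_of S\<^esub> x \<subseteq> I +>\<^bsub>ring_of S\<^esub> y" if "x - y \<in> I" for x y
  proof
    fix z assume "z \<in> I +>\<^bsub>ring_of S\<^esub> x"
    then obtain i where "z = i + x" "i \<in> I" by (auto simp: coset_ring_of)
    then have "z = (i + (x - y)) + y" "i + (x - y) \<in> I" using that ideal_in_add[OF I] by auto
    then show "z \<in> I +>\<^bsub>ring_of S\<^esub> y" unfolding coset_ring_of by blast
  qed
  assume "x - y \<in> I"
  then show "I +>\<^bsub>ring_of S\<^esub> x = I +>\<^bsub>ring_of S\<^esub> y"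
    using sub[of x y] sub[of y x] ideal_in_uminus[OF I, of "x - y"] by auto
qed

lemma ideal_coset_zero: "I +>\<^bsub>ring_of S\<^esub> 0 = I"
  by (simp add: coset_ring_of)

context
  fixes I J assumes I: "ideal_in I" and J: "ideal_in J" and IJ: "I \<subseteq> J"
begin

abbreviation Q where "Q \<equiv> quotient_module (ring_of S) J I"

lemma quotient_module_carrier: "carrier Q = (\<lambda>x. I +>\<^bsub>ring_of S\<^esub> x) ` J"
  by (simp add: quotient_module_def)

lemma quotient_module_zero: "\<zero>\<^bsub>Q\<^esub> = I +>\<^bsub>ring_of S\<^esub> 0"
  by (simp add: quotient_module_def ideal_coset_zero)

lemma quotient_module_add:
  assumes "x \<in> S" "y \<in> S"
  shows "(I +>\<^bsub>ring_of S\<^esub> x) \<oplus>\<^bsub>Q\<^esub> (I +>\<^bsub>ring_of S\<^esub> y) = I +>\<^bsub>ring_of S\<^esub> (x + y)"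
  using ideal.a_rcos_sum[of I "ring_of S" x y] assms I ideal_ring_of_iff
  by (simp add: quotient_module_def)

lemma quotient_module_smult:
  assumes "r \<in> S" "x \<in> S"
  shows "r \<odot>\<^bsub>Q\<^esub> (I +>\<^bsub>ring_of S\<^esub> x) = I +>\<^bsub>ring_of S\<^esub> (r * x)"
  using ideal.rcoset_mult_add[of I "ring_of S" r x] assms I ideal_ring_of_iff
  by (simp add: quotient_module_def)

lemma abelian_monoid_quotient_module: "abelian_monoid Q"
proof (rule abelian_monoidI)
  note J_simps = ideal_in_subset[OF J] ideal_in_zero[OF J] ideal_in_add[OF J]
  show "\<zero>\<^bsub>Q\<^esub> \<in> carrier Q" using J_simps by (auto simp: quotient_module_carrier quotient_module_zero)
qed (auto simp: quotient_module_carrier quotient_module_zero quotient_module_add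
      ideal_in_subset[OF J] ideal_in_add[OF J] add_ac)

lemma smult_closed_quotient_module: "r \<in> S \<Longrightarrow> x \<in> carrier Q \<Longrightarrow> r \<odot>\<^bsub>Q\<^esub> x \<in> carrier Q"
  by (auto simp: quotient_module_carrier quotient_module_smult ideal_in_subset[OF J] ideal_in_mult[OF J])

lemma multiples_ideal_between:
  assumes "set rs \<subseteq> S"
  shows "ideal_in (multiples_ideal J I rs) \<and> I \<subseteq> multiples_ideal J I rs \<and> multiples_ideal J I rs \<subseteq> J"
  using assms
proof (induction rs rule: rev_induct)
  case Nil
  then show ?case using I IJ by (simp add: multiples_ideal_def)
next
  case (snoc r rs)
  then show ?case
    using ideal_in_add_multiple[OF _ J, of "multiples_ideal J I rs" r]
      subset_add_multiple[OF J, of "multiples_ideal J I rs" r]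
      add_multiple_subset[OF J, of "multiples_ideal J I rs" r]
    by (auto simp: multiples_ideal_def)
qed

text \<open>The submodule \<open>(r\<^sub>1, \<dots>, r\<^sub>k) (J/I)\<close> is the image of \<open>I + r\<^sub>1 J + \<dots> + r\<^sub>k J\<close>; this reduces regular
  sequences on the module of cosets to statements about ideals of \<open>S\<close>.\<close>

lemma list_smult_quotient_module:
  assumes "set rs \<subseteq> S"
  shows "list_smult rs Q = (\<lambda>x. I +>\<^bsub>ring_of S\<^esub> x) ` multiples_ideal J I rs"
  using assms
proof (induction rs rule: rev_induct)
  case Nil
  interpret abelian_monoid Q by (rule abelian_monoid_quotient_module)
  have "I +>\<^bsub>ring_of S\<^esub> x = \<zero>\<^bsub>Q\<^esub>" if "x \<in> I" for x
    unfolding quotient_module_zero using coset_eq_iff[OF I] that ideal_in_subset[OF I] by auto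
  then have "(\<lambda>x. I +>\<^bsub>ring_of S\<^esub> x) ` I = {\<zero>\<^bsub>Q\<^esub>}" using ideal_in_zero[OF I] by (auto simp: image_iff)
  then show ?case by (auto simp: list_smult_def multiples_ideal_def)
next
  case (snoc r rs)
  define N where "N = multiples_ideal J I rs"
  have N: "N \<subseteq> J" using multiples_ideal_between[of rs] snoc.prems by (simp add: N_def)
  have r: "r \<in> S" and rs: "set rs \<subseteq> S" using snoc.prems by auto
  have JS: "\<And>x. x \<in> J \<Longrightarrow> x \<in> S" using ideal_in_subset[OF J] .
  have "list_smult (rs @ [r]) Q
      = {y \<oplus>\<^bsub>Q\<^esub> r \<odot>\<^bsub>Q\<^esub> x | y x. y \<in> (\<lambda>x. I +>\<^bsub>ring_of S\<^esub> x) ` N \<and> x \<in> (\<lambda>x. I +>\<^bsub>ring_of S\<^esub> x) ` J}"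
    using snoc smult_closed_quotient_module
    by (subst list_smult_snoc[OF abelian_monoid_quotient_module])
      (auto simp: quotient_module_carrier N_def)
  also have "\<dots> = {(I +>\<^bsub>ring_of S\<^esub> y) \<oplus>\<^bsub>Q\<^esub> r \<odot>\<^bsub>Q\<^esub> (I +>\<^bsub>ring_of S\<^esub> x) | y x. y \<in> N \<and> x \<in> J}"
    by blast
  also have "\<dots> = {I +>\<^bsub>ring_of S\<^esub> (y + r * x) | y x. y \<in> N \<and> x \<in> J}"
  proof -
    have "(I +>\<^bsub>ring_of S\<^esub> y) \<oplus>\<^bsub>Q\<^esub> r \<odot>\<^bsub>Q\<^esub> (I +>\<^bsub>ring_of S\<^esub> x) = I +>\<^bsub>ring_of S\<^esub> (y + r * x)"
      if "y \<in> N" "x \<in> J" for y x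
      using that N JS r by (simp add: quotient_module_smult quotient_module_add subset_iff)
    then show ?thesis by (intro Collect_cong ex_cong1) auto
  qed
  also have "\<dots> = (\<lambda>x. I +>\<^bsub>ring_of S\<^esub> x) ` add_multiple N r J" unfolding add_multiple_def by blast
  finally show ?case by (simp add: multiples_ideal_def N_def)
qed

lemma coset_in_list_smult_iff:
  assumes "set rs \<subseteq> S" "x \<in> J"
  shows "I +>\<^bsub>ring_of S\<^esub> x \<in> list_smult rs Q \<longleftrightarrow> x \<in> multiples_ideal J I rs"
proof
  define N where "N = multiples_ideal J I rs"
  have N: "ideal_in N" "I \<subseteq> N" using multiples_ideal_between[of rs] assms by (auto simp: N_def)
  assume "I +>\<^bsub>ring_of S\<^esub> x \<in> list_smult rs Q"
  then obtain y where y: "y \<in> N" "I +>\<^bsub>ring_of S\<^esub> x = I +>\<^bsub>ring_of S\<^esub> y"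
    using list_smult_quotient_module[OF assms(1)] by (auto simp: N_def)
  then have "x - y \<in> I" using coset_eq_iff[OF I] ideal_in_subset[OF J] ideal_in_subset[OF N(1)] assms by blast
  then have "(x - y) + y \<in> N" using y N by (intro ideal_in_add) auto
  then show "x \<in> multiples_ideal J I rs" by (simp add: N_def)
next
  assume "x \<in> multiples_ideal J I rs"
  then show "I +>\<^bsub>ring_of S\<^esub> x \<in> list_smult rs Q" using list_smult_quotient_module[OF assms(1)] by blast
qed

lemma regular_sequence_quotient_module_iff:
  "regular_sequence (ring_of S) Q rs \<longleftrightarrow> set rs \<subseteq> S \<and>
     (\<forall>i<length rs. regular_on (rs ! i) J (multiples_ideal J I (take i rs))) \<and>
     multiples_ideal J I rs \<noteq> J"
proof (cases "set rs \<subseteq> S")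
  case rs: True
  have take: "set (take i rs) \<subseteq> S" for i using rs set_take_subset by fast
  have nth: "rs ! i \<in> S" if "i < length rs" for i using rs nth_mem[OF that] by blast
  have "(\<forall>x\<in>carrier Q. (rs ! i) \<odot>\<^bsub>Q\<^esub> x \<in> list_smult (take i rs) Q \<longrightarrow> x \<in> list_smult (take i rs) Q)
      \<longleftrightarrow> regular_on (rs ! i) J (multiples_ideal J I (take i rs))" if "i < length rs" for i
    unfolding regular_on_def quotient_module_carrier
    using nth[OF that] ideal_in_mult[OF J nth[OF that]] ideal_in_subset[OF J]
    by (simp add: quotient_module_smult coset_in_list_smult_iff[OF take])
  moreover have "list_smult rs Q \<noteq> carrier Q \<longleftrightarrow> multiples_ideal J I rs \<noteq> J"
  proof -
    have "list_smult rs Q = carrier Q \<longleftrightarrow> multiples_ideal J I rs = J"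
    proof
      assume eq: "list_smult rs Q = carrier Q"
      have "x \<in> multiples_ideal J I rs" if "x \<in> J" for x
        using coset_in_list_smult_iff[OF rs that] that eq by (auto simp: quotient_module_carrier)
      then show "multiples_ideal J I rs = J" using multiples_ideal_between[OF rs] by blast
    qed (use list_smult_quotient_module[OF rs] quotient_module_carrier in simp)
    then show ?thesis by simp
  qed
  ultimately show ?thesis using rs by (auto simp: regular_sequence_def)
qed (auto simp: regular_sequence_def)

lemma depth_ge_if_less_depth:
  assumes "ideal_in m" "enat n < depth (ring_of S) m Q"
  shows "depth_ge m (Suc n) J I"
proof -
  obtain rs where "n < length rs" "set rs \<subseteq> m" "regular_sequence (ring_of S) Q rs"
    using assms(2) unfolding depth_def less_Sup_iff by auto
  then have "depth_ge m (length rs) J I"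
    unfolding regular_sequence_quotient_module_iff depth_ge_iff_list by blast
  then show ?thesis using depth_ge_mono \<open>n < length rs\<close> Suc_leI by blast
qed

lemma annihilator_quotient_module:
  "annihilator (ring_of S) Q = {r \<in> S. \<forall>x\<in>J. r * x \<in> I}"
proof -
  have "r \<odot>\<^bsub>Q\<^esub> (I +>\<^bsub>ring_of S\<^esub> x) = \<zero>\<^bsub>Q\<^esub> \<longleftrightarrow> r * x \<in> I" if "r \<in> S" "x \<in> J" for r x
    using that ideal_in_subset[OF J] coset_eq_iff[OF I, of "r * x" 0]
    by (simp add: quotient_module_smult quotient_module_zero)
  then show ?thesis unfolding annihilator_def quotient_module_carrier by auto
qed

end

text \<open>A sequence in \<open>m\<close> leaves a nonzero quotient of \<open>S/I\<close>, because \<open>I\<close> and all its multiples stay inside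
  the proper ideal \<open>m\<close>.\<close>

lemma depth_ge_le_depth:
  assumes I: "ideal_in I" and m: "ideal_in m" "I \<subseteq> m" "1 \<notin> m" and n: "depth_ge m n S I"
  shows "enat n \<le> depth (ring_of S) m (quotient_module (ring_of S) S I)"
proof -
  have IS: "I \<subseteq> S" using I by (simp add: ideal_in_def)
  have mS: "m \<subseteq> S" using m by (simp add: ideal_in_def)
  obtain rs where rs: "length rs = n" "set rs \<subseteq> m"
    "\<forall>i<n. regular_on (rs ! i) S (multiples_ideal S I (take i rs))"
    using n unfolding depth_ge_iff_list by blast
  have "multiples_ideal S I rs \<subseteq> m" using rs(2)
  proof (induction rs rule: rev_induct)
    case (snoc r rs)
    have "n + r * x \<in> m" if "n \<in> multiples_ideal S I rs" "x \<in> S" for n x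
      using snoc that ideal_in_add[OF m(1)] ideal_in_mult[OF m(1), of x r]
      by (auto simp: mult.commute)
    then show ?case by (auto simp: multiples_ideal_def add_multiple_def)
  qed (simp add: multiples_ideal_def m)
  then have "multiples_ideal S I rs \<noteq> S" using m(3) by auto
  then have "regular_sequence (ring_of S) (quotient_module (ring_of S) S I) rs"
    unfolding regular_sequence_quotient_module_iff[OF I ideal_in_whole IS] using rs mS by auto
  then show ?thesis unfolding depth_def using rs by (intro Sup_upper) auto
qed

lemma krull_dim_ge_prime_chain:
  assumes I: "ideal_in I" "I \<subseteq> P 0" and P: "\<forall>i\<le>n. prime_in (P i)" "\<forall>i<n. P i \<subset> P (Suc i)"
  shows "enat n \<le> krull_dim (ring_of S Quot I)"
proof -
  have I_sub: "I \<subseteq> P i" if "i \<le> n" for i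
    using that
  proof (induction i)
    case (Suc i)
    then have "I \<subseteq> P i" "P i \<subset> P (Suc i)" using P(2) by auto
    then show ?case by blast
  qed (use I in simp)
  have iI: "ideal I (ring_of S)" using I ideal_ring_of_iff by blast
  interpret I: ideal I "ring_of S" by (rule iI)
  interpret Q: cring "ring_of S Quot I" by (rule I.quotient_is_cring[OF cring_ring_of])
  define P' where "P' i = (\<lambda>x. I +>\<^bsub>ring_of S\<^esub> x) ` P i" for i
  have carr: "carrier (ring_of S Quot I) = (\<lambda>x. I +>\<^bsub>ring_of S\<^esub> x) ` S"
    by (auto simp: FactRing_def A_RCOSETS_def')
  have mem: "I +>\<^bsub>ring_of S\<^esub> x \<in> P' i \<longleftrightarrow> x \<in> P i" if "i \<le> n" "x \<in> S" for x i
  proof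
    have Pi: "ideal_in (P i)" using P that prime_in_ideal by blast
    assume "I +>\<^bsub>ring_of S\<^esub> x \<in> P' i"
    then obtain y where y: "y \<in> P i" "I +>\<^bsub>ring_of S\<^esub> x = I +>\<^bsub>ring_of S\<^esub> y" by (auto simp: P'_def)
    then have "x - y \<in> P i"
      using coset_eq_iff[OF I(1) that(2)] ideal_in_subset[OF Pi] I_sub[OF that(1)] by blast
    then have "(x - y) + y \<in> P i" using y(1) by (rule ideal_in_add[OF Pi])
    then show "x \<in> P i" by simp
  qed (auto simp: P'_def)
  have "primeideal (P' i) (ring_of S Quot I)" if i: "i \<le> n" for i
  proof (rule primeidealI)
    have Pi: "prime_in (P i)" "ideal_in (P i)" using P i prime_in_ideal by blast+
    have "P' i = (\<lambda>x. I +>\<^bsub>ring_of S\<^esub> x) ` P i" by (simp add: P'_def)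
    also have "\<dots> = {I +>\<^bsub>ring_of S\<^esub> j | j. j \<in> P i}" by blast
    finally show "ideal (P' i) (ring_of S Quot I)"
      using R.ring_ideal_imp_quot_ideal[OF iI, of "P i"] Pi ideal_ring_of_iff by (simp add: P'_def)
    have "1 \<notin> P i" using Pi by (simp add: prime_in_def)
    then show "carrier (ring_of S Quot I) \<noteq> P' i" using mem[OF i, of 1] carr by auto
    fix a b assume ab: "a \<in> carrier (ring_of S Quot I)" "b \<in> carrier (ring_of S Quot I)"
      "a \<otimes>\<^bsub>ring_of S Quot I\<^esub> b \<in> P' i"
    then obtain x y where xy: "x \<in> S" "y \<in> S" "a = I +>\<^bsub>ring_of S\<^esub> x" "b = I +>\<^bsub>ring_of S\<^esub> y"
      unfolding carr by blast
    have "I +>\<^bsub>ring_of S\<^esub> (x * y) \<in> P' i"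
      using ab(3) xy I.rcoset_mult_add[of x y] by (simp add: FactRing_def)
    then show "a \<in> P' i \<or> b \<in> P' i"
      using mem[OF i] xy prime_inD[OF Pi(1), of x y] by auto
  qed (rule Q.cring_axioms)
  moreover have "P' i \<subset> P' (Suc i)" if i: "i < n" for i
  proof -
    obtain x where x: "x \<in> P (Suc i)" "x \<notin> P i" using P(2) i by blast
    have "x \<in> S" using x P(1) i prime_in_ideal ideal_in_subset by (metis Suc_leI)
    then have "I +>\<^bsub>ring_of S\<^esub> x \<in> P' (Suc i)" "I +>\<^bsub>ring_of S\<^esub> x \<notin> P' i"
      using mem x i by auto
    moreover have "P' i \<subseteq> P' (Suc i)" using P(2) i unfolding P'_def by blast
    ultimately show ?thesis by blast
  qed
  ultimately show ?thesis unfolding krull_dim_def by (intro Sup_upper) auto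
qed

lemma prime_chain_vimage:
  assumes B: "cring B" and h: "h \<in> ring_hom (ring_of S) B" "h ` S = carrier B"
    and P: "\<forall>i\<le>n::nat. primeideal (P i) B" "\<forall>i<n. P i \<subset> P (Suc i)"
  shows "\<exists>P'. (\<forall>i\<le>n. prime_in (P' i)) \<and> (\<forall>i<n. P' i \<subset> P' (Suc i)) \<and> {x \<in> S. h x = \<zero>\<^bsub>B\<^esub>} \<subseteq> P' 0"
proof -
  interpret B: cring B by (rule B)
  interpret h: ring_hom_ring "ring_of S" B h
    by (rule ring_hom_ringI2[OF R.ring_axioms B.ring_axioms h(1)])
  have ideal: "ideal (P i) B" if "i \<le> n" for i using P(1) that primeideal.axioms(1) by blast
  define P' where "P' i = {x \<in> S. h x \<in> P i}" for i
  have "prime_in (P' i)" if "i \<le> n" for i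
    using h.primeideal_vimage[OF cring_ring_of, of "P i"] P(1) that
    by (simp add: P'_def primeideal_ring_of_iff)
  moreover have "P' i \<subset> P' (Suc i)" if i: "i < n" for i
  proof -
    obtain y where y: "y \<in> P (Suc i)" "y \<notin> P i" using P(2) i by blast
    have "y \<in> carrier B" using ideal.Icarr[OF ideal y(1)] i by simp
    then obtain x where "x \<in> S" "h x = y" using h(2) by (metis imageE)
    then have "x \<in> P' (Suc i)" "x \<notin> P' i" using y by (simp_all add: P'_def)
    moreover have "P i \<subseteq> P (Suc i)" using P(2) i by blast
    then have "P' i \<subseteq> P' (Suc i)" by (auto simp: P'_def)
    ultimately show ?thesis by blast
  qed
  moreover have "{x \<in> S. h x = \<zero>\<^bsub>B\<^esub>} \<subseteq> P' 0"
    using additive_subgroup.zero_closed[OF ideal.axioms(1)[OF ideal[of 0]]] by (auto simp: P'_def)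
  ultimately have "(\<forall>i\<le>n. prime_in (P' i)) \<and> (\<forall>i<n. P' i \<subset> P' (Suc i)) \<and>
      {x \<in> S. h x = \<zero>\<^bsub>B\<^esub>} \<subseteq> P' 0"
    by simp
  then show ?thesis by (rule exI[of _ P'])
qed

end

text \<open>If \<open>N\<close> contains the kernel of \<open>h\<close> on \<open>S\<close>, then \<open>h\<close> identifies \<open>S/N\<close> with the
  quotient of the image of \<open>S\<close> by the image of \<open>N\<close>.\<close>

lemma depth_ge_image:
  fixes h :: "'a::comm_ring_1 \<Rightarrow> 'b::comm_ring_1"
  assumes S: "subring_set S" and N: "subring_set.ideal_in S N"
    and mS: "m \<subseteq> S" and mT: "h ` m \<subseteq> m'"
    and add: "\<And>x y. h (x + y) = h x + h y" and mult: "\<And>x y. h (x * y) = h x * h y"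
    and ker: "{x \<in> S. h x = 0} \<subseteq> N" and depth: "depth_ge m n S N"
  shows "depth_ge m' n (h ` S) (h ` N)"
  using depth N ker
proof (induction n arbitrary: N)
  case 0
  then show ?case by simp
next
  case (Suc n)
  interpret subring_set S by (rule S)
  note N = \<open>ideal_in N\<close>
  have diff: "h (x - y) = h x - h y" for x y
    using add[of "x - y" y] by (simp add: eq_diff_eq)
  obtain f where f: "f \<in> m" "regular_on f S N" "depth_ge m n S (add_multiple N f S)"
    using Suc.prems(1) by auto
  have fS: "f \<in> S" using f mS by auto
  have N_iff: "h x \<in> h ` N \<longleftrightarrow> x \<in> N" if "x \<in> S" for x
  proof
    assume "h x \<in> h ` N"
    then obtain y where y: "y \<in> N" "h x = h y" by auto
    then have "h (x - y) = 0" "x - y \<in> S" using that ideal_in_subset[OF N] by (auto simp: diff)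
    then have "x - y \<in> N" using Suc.prems(3) by blast
    then have "(x - y) + y \<in> N" using y by (intro ideal_in_add[OF N])
    then show "x \<in> N" by simp
  qed auto
  have "regular_on (h f) (h ` S) (h ` N)"
    unfolding regular_on_def
  proof (intro ballI impI)
    fix y assume "y \<in> h ` S" "h f * y \<in> h ` N"
    then obtain x where x: "x \<in> S" "y = h x" "h (f * x) \<in> h ` N" by (auto simp: mult)
    have "f * x \<in> N" using N_iff[OF mult_closed[OF fS x(1)]] x(3) by blast
    then have "x \<in> N" using f(2) x(1) by (simp add: regular_on_def)
    then show "y \<in> h ` N" using x by blast
  qed
  moreover have "h ` add_multiple N f S = add_multiple (h ` N) (h f) (h ` S)"
  proof (intro subset_antisym subsetI)
    fix z assume "z \<in> h ` add_multiple N f S"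
    then obtain n x where "z = h (n + f * x)" "n \<in> N" "x \<in> S" by (auto simp: add_multiple_def)
    then show "z \<in> add_multiple (h ` N) (h f) (h ` S)" by (auto simp: add mult intro: add_multipleI)
  next
    fix z assume "z \<in> add_multiple (h ` N) (h f) (h ` S)"
    then obtain n x where "z = h n + h f * h x" "n \<in> N" "x \<in> S" by (auto simp: add_multiple_def)
    then have "z = h (n + f * x)" "n + f * x \<in> add_multiple N f S"
      by (simp_all add: add mult add_multipleI)
    then show "z \<in> h ` add_multiple N f S" by blast
  qed
  moreover have "depth_ge m' n (h ` S) (h ` add_multiple N f S)"
  proof (rule Suc.IH[OF f(3)])
    show "ideal_in (add_multiple N f S)" using N fS by (intro ideal_in_add_multiple ideal_in_whole)
    show "{x \<in> S. h x = 0} \<subseteq> add_multiple N f S"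
      using Suc.prems(3) subset_add_multiple[OF ideal_in_whole] by blast
  qed
  ultimately show ?case using f(1) mT by auto
qed

section \<open>Ideals spanned by monomials\<close>

lemma poly_ring_eq_ring_of: "poly_ring k V = ring_of (polys V)"
  by (simp add: poly_ring_def ring_of_def polys_def)

text \<open>For a complex on \<open>V\<close> this is its Stanley--Reisner ideal; for the complex \<open>{{}}\<close> it is the ideal
  generated by the variables, so both kinds of ideal are treated together.\<close>

definition face_ideal :: "'v set \<Rightarrow> 'v set set \<Rightarrow> (('v \<Rightarrow>\<^sub>0 nat) \<Rightarrow>\<^sub>0 'k::field) set" where
  "face_ideal V \<Delta> = {p \<in> polys V. \<forall>m\<in>Poly_Mapping.keys p. Poly_Mapping.keys m \<notin> \<Delta>}"

definition down_closed :: "'v set set \<Rightarrow> bool" where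
  "down_closed \<Delta> \<longleftrightarrow> (\<forall>\<sigma>\<in>\<Delta>. \<forall>\<tau>. \<tau> \<subseteq> \<sigma> \<longrightarrow> \<tau> \<in> \<Delta>)"

lemma down_closedD: "down_closed \<Delta> \<Longrightarrow> \<sigma> \<in> \<Delta> \<Longrightarrow> \<tau> \<subseteq> \<sigma> \<Longrightarrow> \<tau> \<in> \<Delta>"
  by (auto simp: down_closed_def)

lemma ideal_in_face_ideal:
  assumes "down_closed \<Delta>"
  shows "subring_set.ideal_in (polys V) (face_ideal V \<Delta> :: (('v \<Rightarrow>\<^sub>0 nat) \<Rightarrow>\<^sub>0 'k::field) set)"
proof -
  interpret subring_set "polys V :: (('v \<Rightarrow>\<^sub>0 nat) \<Rightarrow>\<^sub>0 'k) set" by (rule subring_set_polys)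
  show ?thesis
  proof (rule ideal_inI)
    fix r x :: "('v \<Rightarrow>\<^sub>0 nat) \<Rightarrow>\<^sub>0 'k" assume r: "r \<in> polys V" and x: "x \<in> face_ideal V \<Delta>"
    have "Poly_Mapping.keys m \<notin> \<Delta>" if m: "m \<in> Poly_Mapping.keys (r * x)" for m
    proof
      obtain a b where ab: "m = a + b" "b \<in> Poly_Mapping.keys x" using keys_mult[of r x] m by blast
      assume "Poly_Mapping.keys m \<in> \<Delta>"
      then have "Poly_Mapping.keys b \<in> \<Delta>"
        by (rule down_closedD[OF assms]) (simp add: ab keys_add_monomial)
      then show False using ab x by (simp add: face_ideal_def)
    qed
    then show "r * x \<in> face_ideal V \<Delta>" using r x by (simp add: face_ideal_def mult_closed)
  next
    fix x y :: "('v \<Rightarrow>\<^sub>0 nat) \<Rightarrow>\<^sub>0 'k" assume "x \<in> face_ideal V \<Delta>" "y \<in> face_ideal V \<Delta>"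
    then show "x + y \<in> face_ideal V \<Delta>"
      using Poly_Mapping.keys_add[of x y] by (fastforce simp: face_ideal_def)
  qed (auto simp: face_ideal_def)
qed

lemma monomials_in_ideal:
  fixes I :: "(('v \<Rightarrow>\<^sub>0 nat) \<Rightarrow>\<^sub>0 'k::field) set"
  assumes I: "subring_set.ideal_in (polys V) I" and p: "p \<in> polys V"
    and div: "\<And>m. m \<in> Poly_Mapping.keys p \<Longrightarrow> \<exists>g h. Poly_Mapping.single g 1 \<in> I \<and> m = h + g"
  shows "p \<in> I"
proof -
  interpret subring_set "polys V :: (('v \<Rightarrow>\<^sub>0 nat) \<Rightarrow>\<^sub>0 'k) set" by (rule subring_set_polys)
  have "Poly_Mapping.single m (Poly_Mapping.lookup p m) \<in> I" if m: "m \<in> Poly_Mapping.keys p" for m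
  proof -
    obtain g h where gh: "Poly_Mapping.single g 1 \<in> I" "m = h + g" using div[OF m] by blast
    have "Poly_Mapping.keys m \<subseteq> V" using p m by (simp add: polys_def)
    then have "Poly_Mapping.keys h \<subseteq> V" by (simp add: gh(2) keys_add_monomial)
    then have "Poly_Mapping.single h (Poly_Mapping.lookup p m) \<in> polys V" by (simp add: polys_def)
    then have "Poly_Mapping.single h (Poly_Mapping.lookup p m) * Poly_Mapping.single g 1 \<in> I"
      using gh(1) by (rule ideal_in_mult[OF I])
    then show ?thesis using gh(2) by (simp add: mult_single)
  qed
  then show ?thesis by (subst sum_of_monomials[of p]) (rule ideal_in_sum[OF I])
qed

lemma sum_singles_lookup:
  "finite \<sigma> \<Longrightarrow> Poly_Mapping.lookup (\<Sum>v\<in>\<sigma>. Poly_Mapping.single v (1::nat)) x = (if x \<in> \<sigma> then 1 else 0)"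
  by (induction \<sigma> rule: finite_induct) (auto simp: lookup_add lookup_single when_def)

lemma prod_pvar:
  fixes k :: "'k::field itself"
  shows "finite \<sigma> \<Longrightarrow> (\<Prod>v\<in>\<sigma>. pvar k v) = Poly_Mapping.single (\<Sum>v\<in>\<sigma>. Poly_Mapping.single v 1) 1"
  by (induction \<sigma> rule: finite_induct) (simp_all add: pvar_def mult_single)

lemma monomial_divisible_by_support:
  assumes "finite \<sigma>" "\<sigma> \<subseteq> Poly_Mapping.keys m"
  shows "\<exists>h. m = h + (\<Sum>v\<in>\<sigma>. Poly_Mapping.single v (1::nat))"
proof
  show "m = (m - (\<Sum>v\<in>\<sigma>. Poly_Mapping.single v 1)) + (\<Sum>v\<in>\<sigma>. Poly_Mapping.single v (1::nat))"
  proof (rule poly_mapping_eqI)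
    fix x
    have "x \<in> \<sigma> \<Longrightarrow> Poly_Mapping.lookup m x \<noteq> 0" using assms(2) by (auto simp: Poly_Mapping.in_keys_iff)
    then have "x \<in> \<sigma> \<Longrightarrow> 1 \<le> Poly_Mapping.lookup m x" by (simp add: Suc_le_eq)
    then show "Poly_Mapping.lookup m x = Poly_Mapping.lookup
        ((m - (\<Sum>v\<in>\<sigma>. Poly_Mapping.single v 1)) + (\<Sum>v\<in>\<sigma>. Poly_Mapping.single v 1)) x"
      by (simp add: lookup_add lookup_minus sum_singles_lookup[OF assms(1)] del: One_nat_def)
  qed
qed

text \<open>The products over \<open>F\<close> generate because every monomial supported on a nonface is divisible by one of them.\<close>

lemma generated_face_ideal:
  fixes k :: "'k::field itself" and V :: "'v set"
  assumes "finite V" "down_closed \<Delta>"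
    and F: "F \<subseteq> {\<sigma>. \<sigma> \<subseteq> V \<and> \<sigma> \<notin> \<Delta>}"
    and minimal: "\<And>\<tau>. \<tau> \<subseteq> V \<Longrightarrow> \<tau> \<notin> \<Delta> \<Longrightarrow> \<exists>\<sigma>\<in>F. \<sigma> \<subseteq> \<tau>"
  shows "Idl\<^bsub>poly_ring k V\<^esub> ((\<lambda>\<sigma>. \<Prod>v\<in>\<sigma>. pvar k v) ` F) = face_ideal V \<Delta>"
proof -
  interpret subring_set "polys V :: (('v \<Rightarrow>\<^sub>0 nat) \<Rightarrow>\<^sub>0 'k) set" by (rule subring_set_polys)
  define g :: "'v set \<Rightarrow> 'v \<Rightarrow>\<^sub>0 nat" where "g \<sigma> = (\<Sum>v\<in>\<sigma>. Poly_Mapping.single v 1)" for \<sigma>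
  have F_finite: "finite \<sigma>" if "\<sigma> \<in> F" for \<sigma> using that F assms(1) finite_subset by blast
  have gens: "(\<Prod>v\<in>\<sigma>. pvar k v) = Poly_Mapping.single (g \<sigma>) 1" if "\<sigma> \<in> F" for \<sigma>
    using prod_pvar[OF F_finite[OF that]] by (simp add: g_def)
  have keys_g: "Poly_Mapping.keys (g \<sigma>) = \<sigma>" if "\<sigma> \<in> F" for \<sigma>
    using sum_singles_lookup[OF F_finite[OF that]] by (auto simp: g_def Poly_Mapping.in_keys_iff split: if_splits)
  have gens_in: "(\<lambda>\<sigma>. \<Prod>v\<in>\<sigma>. pvar k v) ` F \<subseteq> face_ideal V \<Delta>"
  proof (intro image_subsetI)
    fix \<sigma> assume \<sigma>: "\<sigma> \<in> F"
    then have "\<sigma> \<subseteq> V" "\<sigma> \<notin> \<Delta>" using F by auto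
    then show "(\<Prod>v\<in>\<sigma>. pvar k v) \<in> face_ideal V \<Delta>"
      by (simp add: gens[OF \<sigma>] keys_g[OF \<sigma>] face_ideal_def polys_def)
  qed
  define I where "I = Idl\<^bsub>ring_of (polys V)\<^esub> ((\<lambda>\<sigma>. \<Prod>v\<in>\<sigma>. pvar k v) ` F)"
  have sub: "(\<lambda>\<sigma>. \<Prod>v\<in>\<sigma>. pvar k v) ` F \<subseteq> carrier (ring_of (polys V))"
    using gens_in by (auto simp: face_ideal_def)
  have I: "ideal_in I" unfolding I_def ideal_ring_of_iff[symmetric] by (rule R.genideal_ideal[OF sub])
  have "I \<subseteq> face_ideal V \<Delta>" unfolding I_def
    by (rule R.genideal_minimal[OF _ gens_in]) (simp add: ideal_ring_of_iff ideal_in_face_ideal assms)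
  moreover have "p \<in> I" if p: "p \<in> face_ideal V \<Delta>" for p
  proof (rule monomials_in_ideal[OF I])
    show "p \<in> polys V" using p by (simp add: face_ideal_def)
    fix m assume m: "m \<in> Poly_Mapping.keys p"
    then obtain \<sigma> where \<sigma>: "\<sigma> \<in> F" "\<sigma> \<subseteq> Poly_Mapping.keys m"
      using minimal[of "Poly_Mapping.keys m"] p by (auto simp: face_ideal_def polys_def)
    have "Poly_Mapping.single (g \<sigma>) 1 \<in> I"
      using R.genideal_self[OF sub] gens[OF \<sigma>(1)] \<sigma>(1) unfolding I_def by force
    moreover obtain h where "m = h + g \<sigma>"
      using monomial_divisible_by_support[OF F_finite[OF \<sigma>(1)] \<sigma>(2)] by (auto simp: g_def)
    ultimately show "\<exists>g h. Poly_Mapping.single g 1 \<in> I \<and> m = h + g" by blast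
  qed
  ultimately show ?thesis by (auto simp: I_def poly_ring_eq_ring_of)
qed

lemma sr_ideal_eq_face_ideal:
  assumes "finite V" "down_closed \<Delta>"
  shows "sr_ideal k V \<Delta> = face_ideal V \<Delta>"
proof -
  have "{\<Prod>v\<in>\<sigma>. pvar k v | \<sigma>. \<sigma> \<subseteq> V \<and> \<sigma> \<notin> \<Delta>} = (\<lambda>\<sigma>. \<Prod>v\<in>\<sigma>. pvar k v) ` {\<sigma>. \<sigma> \<subseteq> V \<and> \<sigma> \<notin> \<Delta>}"
    by blast
  then show ?thesis unfolding sr_ideal_def using assms by (simp only:) (rule generated_face_ideal, auto)
qed

lemma irrelevant_ideal_eq_face_ideal:
  assumes "finite V"
  shows "irrelevant_ideal k V = face_ideal V {{}}"
proof -
  have "pvar k ` V = (\<lambda>\<sigma>. \<Prod>v\<in>\<sigma>. pvar k v) ` ((\<lambda>v. {v}) ` V)" by (simp add: image_image)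
  then show ?thesis unfolding irrelevant_ideal_def using assms
    by (simp only:) (rule generated_face_ideal, auto simp: down_closed_def)
qed

definition monomial_degree :: "('v \<Rightarrow>\<^sub>0 nat) \<Rightarrow> nat" where
  "monomial_degree m = (\<Sum>v\<in>Poly_Mapping.keys m. Poly_Mapping.lookup m v)"

lemma monomial_degree_add: "monomial_degree (a + b) = monomial_degree a + monomial_degree b"
proof -
  have "monomial_degree c = (\<Sum>v\<in>Poly_Mapping.keys (a + b). Poly_Mapping.lookup c v)"
    if "Poly_Mapping.keys c \<subseteq> Poly_Mapping.keys (a + b)" for c
    unfolding monomial_degree_def
    by (rule sum.mono_neutral_left) (use that in \<open>auto simp: Poly_Mapping.in_keys_iff\<close>)
  then show ?thesis by (simp add: keys_add_monomial lookup_add sum.distrib)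
qed

lemma monomial_degree_pos: "a \<noteq> 0 \<Longrightarrow> 0 < monomial_degree a"
proof -
  assume "a \<noteq> 0"
  then obtain v where "v \<in> Poly_Mapping.keys a" using keys_eq_empty by blast
  then show ?thesis unfolding monomial_degree_def
    by (intro sum_pos2[of _ v]) (auto simp: Poly_Mapping.in_keys_iff)
qed

text \<open>Let \<open>m\<close> be a monomial of \<open>x\<close> of least degree among those supported on faces.  In \<open>s x\<close> it can
  only come from the constant term of \<open>s\<close>: another contribution would involve a proper divisor of \<open>m\<close>, which
  is again supported on a face.  So \<open>m\<close> occurs in \<open>s x\<close>.\<close>

lemma face_ideal_saturated:
  fixes s x :: "('v \<Rightarrow>\<^sub>0 nat) \<Rightarrow>\<^sub>0 'k::field"
  assumes \<Delta>: "down_closed \<Delta>" and s: "Poly_Mapping.lookup s 0 \<noteq> 0" and x: "x \<in> polys V"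
    and sx: "s * x \<in> face_ideal V \<Delta>"
  shows "x \<in> face_ideal V \<Delta>"
proof (rule ccontr)
  define bad where "bad b \<longleftrightarrow> b \<in> Poly_Mapping.keys x \<and> Poly_Mapping.keys b \<in> \<Delta>" for b
  assume "x \<notin> face_ideal V \<Delta>"
  then have "\<exists>b. bad b" using x by (auto simp: face_ideal_def bad_def)
  then obtain b0 where "bad b0" ..
  from ex_has_least_nat[of bad, OF this, of monomial_degree]
  obtain m where m: "bad m" and min: "\<forall>b. bad b \<longrightarrow> monomial_degree m \<le> monomial_degree b"
    by blast
  define c where "c = Poly_Mapping.lookup s 0"
  define t where "t = s - Poly_Mapping.single 0 c"
  have t0: "0 \<notin> Poly_Mapping.keys t"
    by (simp add: t_def c_def Poly_Mapping.in_keys_iff lookup_minus)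
  have "m \<notin> Poly_Mapping.keys (t * x)"
  proof
    assume "m \<in> Poly_Mapping.keys (t * x)"
    then obtain a b where ab: "m = a + b" "a \<in> Poly_Mapping.keys t" "b \<in> Poly_Mapping.keys x"
      using keys_mult[of t x] by blast
    have "Poly_Mapping.keys b \<in> \<Delta>"
      by (rule down_closedD[OF \<Delta>, of "Poly_Mapping.keys m"])
        (use m ab in \<open>auto simp: bad_def keys_add_monomial\<close>)
    then have "monomial_degree m \<le> monomial_degree b" using ab min by (simp add: bad_def)
    moreover have "a \<noteq> 0" using ab t0 by auto
    ultimately show False using monomial_degree_pos[of a] ab by (simp add: monomial_degree_add)
  qed
  moreover have "m \<notin> Poly_Mapping.keys (s * x)" using sx m by (auto simp: face_ideal_def bad_def)
  moreover have "Poly_Mapping.single 0 c * x = s * x - t * x" by (simp add: t_def algebra_simps)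
  ultimately have cx: "m \<notin> Poly_Mapping.keys (Poly_Mapping.single 0 c * x)"
    using keys_diff[of "s * x" "t * x"] by auto
  have "x = Poly_Mapping.single 0 (1 / c) * (Poly_Mapping.single 0 c * x)"
    using s by (simp add: c_def mult_single flip: mult.assoc)
  then have "m \<in> Poly_Mapping.keys (Poly_Mapping.single 0 (1 / c) * (Poly_Mapping.single 0 c * x))"
    using m by (simp add: bad_def)
  then have "m \<in> Poly_Mapping.keys (Poly_Mapping.single 0 c * x)"
    using keys_mult[of "Poly_Mapping.single 0 (1 / c)" "Poly_Mapping.single 0 c * x"]
    by (auto split: if_splits)
  then show False using cx by contradiction
qed

lemma in_irrelevant_iff:
  fixes p :: "('v \<Rightarrow>\<^sub>0 nat) \<Rightarrow>\<^sub>0 'k::field"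
  shows "p \<in> face_ideal V {{}} \<longleftrightarrow> p \<in> polys V \<and> Poly_Mapping.lookup p 0 = 0"
  by (auto simp: face_ideal_def Poly_Mapping.in_keys_iff)

text \<open>Primality is saturation for the complex \<open>{{}}\<close>: a factor outside the ideal has a nonzero constant
  term and can be cancelled.\<close>

lemma prime_in_irrelevant:
  "subring_set.prime_in (polys V) (face_ideal V {{}} :: (('v \<Rightarrow>\<^sub>0 nat) \<Rightarrow>\<^sub>0 'k::field) set)"
proof -
  interpret subring_set "polys V :: (('v \<Rightarrow>\<^sub>0 nat) \<Rightarrow>\<^sub>0 'k) set" by (rule subring_set_polys)
  have dc: "down_closed {{} :: 'v set}" by (simp add: down_closed_def)
  show ?thesis unfolding prime_in_def
    using ideal_in_face_ideal[OF dc, where V = V and 'k = 'k] face_ideal_saturated[OF dc]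
    by (auto simp: in_irrelevant_iff[of 1]) (auto simp: in_irrelevant_iff)
qed

section \<open>Setting variables to zero\<close>

text \<open>The homomorphism that sets the variables outside \<open>W\<close> to zero; it drops the monomials that involve one of them.\<close>

definition restrict_vars :: "'v set \<Rightarrow> (('v \<Rightarrow>\<^sub>0 nat) \<Rightarrow>\<^sub>0 'k::field) \<Rightarrow> (('v \<Rightarrow>\<^sub>0 nat) \<Rightarrow>\<^sub>0 'k)" where
  "restrict_vars W p = (\<Sum>m\<in>{m\<in>Poly_Mapping.keys p. Poly_Mapping.keys m \<subseteq> W}.
     Poly_Mapping.single m (Poly_Mapping.lookup p m))"

lemma lookup_restrict_vars:
  "Poly_Mapping.lookup (restrict_vars W p) m = (if Poly_Mapping.keys m \<subseteq> W then Poly_Mapping.lookup p m else 0)"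
proof -
  define A where "A = {m\<in>Poly_Mapping.keys p. Poly_Mapping.keys m \<subseteq> W}"
  have "Poly_Mapping.lookup (restrict_vars W p) m
      = (\<Sum>a\<in>A. if a = m then Poly_Mapping.lookup p m else 0)"
    unfolding restrict_vars_def A_def[symmetric] lookup_sum
    by (intro sum.cong refl) (auto simp: lookup_single)
  also have "\<dots> = (if m \<in> A then Poly_Mapping.lookup p m else 0)"
    by (simp add: sum.delta' A_def)
  finally show ?thesis by (auto simp: A_def Poly_Mapping.in_keys_iff)
qed

lemma restrict_vars_add: "restrict_vars W (p + q) = restrict_vars W p + restrict_vars W q"
  by (rule poly_mapping_eqI) (simp add: lookup_restrict_vars lookup_add)

lemma restrict_vars_in_polys: "restrict_vars W p \<in> polys W"
proof -
  have "Poly_Mapping.keys m \<subseteq> W" if "m \<in> Poly_Mapping.keys (restrict_vars W p)" for m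
    using that by (simp add: Poly_Mapping.in_keys_iff lookup_restrict_vars split: if_splits)
  then show ?thesis by (simp add: polys_def)
qed

lemma restrict_vars_id: "p \<in> polys W \<Longrightarrow> restrict_vars W p = p"
  by (rule poly_mapping_eqI) (auto simp: lookup_restrict_vars polys_def Poly_Mapping.in_keys_iff)

lemma restrict_vars_eq_0_iff:
  "restrict_vars W p = 0 \<longleftrightarrow> (\<forall>m\<in>Poly_Mapping.keys p. \<not> Poly_Mapping.keys m \<subseteq> W)"
  by (auto simp: poly_mapping_eq_iff fun_eq_iff lookup_restrict_vars Poly_Mapping.in_keys_iff)

lemma restrict_vars_mult_zero: "restrict_vars W q = 0 \<Longrightarrow> restrict_vars W (p * q) = 0"
  unfolding restrict_vars_eq_0_iff using keys_mult[of p q] by (fastforce simp: keys_add_monomial)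

text \<open>The polynomials sent to zero form an ideal, and every polynomial differs from its restriction by one
  of them.\<close>

lemma restrict_vars_mult: "restrict_vars W (p * q) = restrict_vars W p * restrict_vars W q"
proof -
  define p' q' where "p' = restrict_vars W p" and "q' = restrict_vars W q"
  have zero: "restrict_vars W (p - p') = 0" "restrict_vars W (q - q') = 0"
    by (rule poly_mapping_eqI, simp add: lookup_restrict_vars lookup_minus p'_def q'_def)+
  have "p * q = p' * q' + (p' * (q - q') + q * (p - p'))" by (simp add: algebra_simps)
  then have "restrict_vars W (p * q) = restrict_vars W (p' * q')"
    using restrict_vars_mult_zero[OF zero(1), of q] restrict_vars_mult_zero[OF zero(2), of p']
    by (simp only: restrict_vars_add add_0_right)
  also have "p' * q' \<in> polys W"
    unfolding p'_def q'_def by (intro subring_set.mult_closed[OF subring_set_polys] restrict_vars_in_polys)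
  then have "restrict_vars W (p' * q') = p' * q'" by (rule restrict_vars_id)
  finally show ?thesis by (simp add: p'_def q'_def)
qed

lemma restrict_vars_one: "restrict_vars W 1 = 1"
  by (rule restrict_vars_id) (simp add: polys_def)

lemma restrict_vars_image_polys: "W \<subseteq> V \<Longrightarrow> restrict_vars W ` polys V = polys W"
  using restrict_vars_in_polys[of W] restrict_vars_id[of _ W]
  by (force simp: polys_def image_iff)

lemma restrict_vars_image_face_ideal:
  assumes "W \<subseteq> V"
  shows "restrict_vars W ` face_ideal V \<Delta> = face_ideal W \<Delta>"
proof (intro subset_antisym subsetI)
  fix p assume "p \<in> restrict_vars W ` face_ideal V \<Delta>"
  then show "p \<in> face_ideal W \<Delta>"
    by (auto simp: face_ideal_def restrict_vars_in_polys)
      (auto simp: Poly_Mapping.in_keys_iff lookup_restrict_vars split: if_splits)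
next
  fix p assume p: "p \<in> face_ideal W \<Delta>"
  then have "p \<in> face_ideal V \<Delta>" using assms by (auto simp: face_ideal_def polys_def)
  moreover have "restrict_vars W p = p" using p by (intro restrict_vars_id) (simp add: face_ideal_def)
  ultimately show "p \<in> restrict_vars W ` face_ideal V \<Delta>" by (metis imageI)
qed

section \<open>Cohen--Macaulay extenders\<close>

lemma noetherian_subring_polys:
  assumes "finite V"
  shows "noetherian_subring (polys V :: (('v \<Rightarrow>\<^sub>0 nat) \<Rightarrow>\<^sub>0 'k::field) set)"
proof -
  interpret subring_set "polys V :: (('v \<Rightarrow>\<^sub>0 nat) \<Rightarrow>\<^sub>0 'k) set" by (rule subring_set_polys)
  show ?thesis by unfold_locales (rule noetherian_polys[OF assms])
qed

lemma face_ideal_antimono: "\<Delta> \<subseteq> \<Gamma> \<Longrightarrow> face_ideal V \<Gamma> \<subseteq> face_ideal V \<Delta>"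
  by (auto simp: face_ideal_def)

lemma simplicial_complexD:
  assumes "simplicial_complex \<Delta>"
  shows "finite (\<Union>\<Delta>)" "down_closed \<Delta>"
  using assms by (auto simp: simplicial_complex_def down_closed_def)

text \<open>The Stanley--Reisner ring of \<open>\<Delta>\<close> is a quotient of that of \<open>\<Gamma>\<close>, so chains of primes pull back.\<close>

lemma sr_dim_mono:
  fixes k :: "'k::field itself"
  assumes \<Delta>: "simplicial_complex \<Delta>" and \<Gamma>: "simplicial_complex \<Gamma>" and sub: "\<Delta> \<subseteq> \<Gamma>"
  shows "sr_dim k \<Delta> \<le> sr_dim k \<Gamma>"
proof -
  define V W where "V = \<Union>\<Gamma>" and "W = \<Union>\<Delta>"
  have fin: "finite V" "finite W" and WV: "W \<subseteq> V"
    using \<Delta> \<Gamma> sub by (auto simp: V_def W_def simplicial_complexD Union_mono)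
  interpret V: subring_set "polys V :: (('a \<Rightarrow>\<^sub>0 nat) \<Rightarrow>\<^sub>0 'k) set" by (rule subring_set_polys)
  interpret W: subring_set "polys W :: (('a \<Rightarrow>\<^sub>0 nat) \<Rightarrow>\<^sub>0 'k) set" by (rule subring_set_polys)
  define I where "I = (face_ideal W \<Delta> :: (('a \<Rightarrow>\<^sub>0 nat) \<Rightarrow>\<^sub>0 'k) set)"
  define K where "K = (face_ideal V \<Gamma> :: (('a \<Rightarrow>\<^sub>0 nat) \<Rightarrow>\<^sub>0 'k) set)"
  have I: "W.ideal_in I" and K: "V.ideal_in K"
    using \<Delta> \<Gamma> by (simp_all add: I_def K_def ideal_in_face_ideal simplicial_complexD)
  define B where "B = ring_of (polys W) Quot I"
  have dims: "sr_dim k \<Delta> = krull_dim B" "sr_dim k \<Gamma> = krull_dim (ring_of (polys V) Quot K)"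
    unfolding sr_dim_def sr_ring_def B_def I_def K_def poly_ring_eq_ring_of
    using fin sr_ideal_eq_face_ideal[OF fin(1), of \<Gamma> k] sr_ideal_eq_face_ideal[OF fin(2), of \<Delta> k]
      simplicial_complexD[OF \<Delta>] simplicial_complexD[OF \<Gamma>] by (simp_all add: V_def W_def)
  interpret I: ideal I "ring_of (polys W)" using I W.ideal_ring_of_iff by blast
  have B: "cring B" unfolding B_def by (rule I.quotient_is_cring[OF W.cring_ring_of])
  define h where "h = (\<lambda>p. I +>\<^bsub>ring_of (polys W)\<^esub> restrict_vars W p)"
  have "restrict_vars W \<in> ring_hom (ring_of (polys V)) (ring_of (polys W))"
    by (rule ring_hom_memI)
      (simp_all add: restrict_vars_in_polys restrict_vars_mult restrict_vars_add restrict_vars_one)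
  from ring_hom_trans[OF this I.rcos_ring_hom]
  have h: "h \<in> ring_hom (ring_of (polys V)) B" by (simp add: h_def B_def comp_def)
  have carr: "carrier B = (\<lambda>x. I +>\<^bsub>ring_of (polys W)\<^esub> x) ` polys W"
    by (auto simp: B_def FactRing_def A_RCOSETS_def')
  have h_surj: "h ` polys V = carrier B"
    unfolding carr h_def restrict_vars_image_polys[OF WV, symmetric] image_image ..
  have ker: "K \<subseteq> {x \<in> polys V. h x = \<zero>\<^bsub>B\<^esub>}"
  proof
    fix x assume x: "x \<in> K"
    then have "x \<in> face_ideal V \<Delta>" using face_ideal_antimono[OF sub] by (auto simp: K_def)
    then have "restrict_vars W x \<in> I"
      unfolding I_def restrict_vars_image_face_ideal[OF WV, symmetric] by blast
    then have "I +>\<^bsub>ring_of (polys W)\<^esub> restrict_vars W x = I +>\<^bsub>ring_of (polys W)\<^esub> 0"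
      using W.coset_eq_iff[OF I, of "restrict_vars W x" 0] W.ideal_in_subset[OF I] by simp
    then show "x \<in> {x \<in> polys V. h x = \<zero>\<^bsub>B\<^esub>}"
      using x V.ideal_in_subset[OF K] by (simp add: h_def B_def FactRing_def W.ideal_coset_zero)
  qed
  show ?thesis unfolding dims krull_dim_def[of B]
  proof (rule Sup_least)
    fix d assume "d \<in> {enat n |n. \<exists>P. (\<forall>i\<le>n. primeideal (P i) B) \<and> (\<forall>i<n. P i \<subset> P (Suc i))}"
    then obtain n P where d: "d = enat n"
      and P: "\<forall>i\<le>n::nat. primeideal (P i) B" "\<forall>i<n. P i \<subset> P (Suc i)" by blast
    from V.prime_chain_vimage[OF B h h_surj P] obtain P' where
      "\<forall>i\<le>n. V.prime_in (P' i)" "\<forall>i<n. P' i \<subset> P' (Suc i)" "{x \<in> polys V. h x = \<zero>\<^bsub>B\<^esub>} \<subseteq> P' 0"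
      by (elim exE conjE)
    then show "d \<le> krull_dim (ring_of (polys V) Quot K)"
      unfolding d using ker by (intro V.krull_dim_ge_prime_chain[OF K]) auto
  qed
qed

text \<open>The complex without faces has the zero ring, which has no prime ideals.\<close>

lemma empty_face_if_sr_dim_pos:
  fixes k :: "'k::field itself"
  assumes \<Delta>: "simplicial_complex \<Delta>" and pos: "0 < sr_dim k \<Delta>"
  shows "{} \<in> \<Delta>"
proof (rule ccontr)
  assume "{} \<notin> \<Delta>"
  then have "\<Delta> = {}" using simplicial_complexD(2)[OF \<Delta>] by (auto simp: down_closed_def)
  interpret subring_set "polys {} :: (('a \<Rightarrow>\<^sub>0 nat) \<Rightarrow>\<^sub>0 'k) set" by (rule subring_set_polys)
  define B where "B = ring_of (polys {}) Quot (polys {} :: (('a \<Rightarrow>\<^sub>0 nat) \<Rightarrow>\<^sub>0 'k) set)"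
  have "sr_ideal k {} {} = (polys {} :: (('a \<Rightarrow>\<^sub>0 nat) \<Rightarrow>\<^sub>0 'k) set)"
    using sr_ideal_eq_face_ideal[of "{}" "{}" k] by (simp add: down_closed_def face_ideal_def)
  then have dim: "sr_dim k \<Delta> = krull_dim B"
    by (simp add: \<open>\<Delta> = {}\<close> sr_dim_def sr_ring_def poly_ring_eq_ring_of B_def)
  have "{enat n |n. \<exists>P. (\<forall>i\<le>n::nat. primeideal (P i) B) \<and> (\<forall>i<n. P i \<subset> P (Suc i))} \<noteq> {}"
  proof
    assume "{enat n |n. \<exists>P. (\<forall>i\<le>n::nat. primeideal (P i) B) \<and> (\<forall>i<n. P i \<subset> P (Suc i))} = {}"
    then have "krull_dim B = 0" unfolding krull_dim_def by (simp only: Sup_empty bot_enat_def)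
    then show False using pos dim by simp
  qed
  then obtain n P where P: "\<forall>i\<le>n::nat. primeideal (P i) B" by blast
  interpret P: primeideal "P 0" B using P by simp
  have "carrier B = {\<zero>\<^bsub>B\<^esub>}"
    using coset_eq_iff[OF ideal_in_whole, of _ 0]
    by (auto simp: B_def FactRing_def A_RCOSETS_def' ideal_coset_zero)
  then show False using P.I_notcarr P.zero_closed P.a_subset by auto
qed

text \<open>An element \<open>a\<close> of \<open>J - I\<close> does not vanish at \<open>m\<close>, so the depth of \<open>S/I\<close> produces a chain of primes
  above the annihilator of \<open>J/I\<close>.  Hence the dimension of \<open>J/I\<close>, which is its depth, is at least the
  depth of \<open>S/I\<close>, and the depth lemma bounds the depth of \<open>S/J\<close> with a loss of one.  Finally the
  variables that are not vertices of \<open>\<Delta>\<close> are set to zero.\<close>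

lemma depth_drop_at_most_one:
  fixes k :: "'k::field itself" and \<Delta> \<Gamma> :: "'v set set"
  assumes \<Gamma>: "simplicial_complex \<Gamma>" and \<Delta>: "simplicial_complex \<Delta>" and sub: "\<Delta> \<subseteq> \<Gamma>"
    and empty: "{} \<in> \<Delta>" and rel: "relative_cohen_macaulay k \<Gamma> \<Delta>"
    and depth: "enat (Suc g) < sr_depth k \<Gamma>"
  shows "enat (Suc g) \<le> sr_depth k \<Delta>"
proof -
  define V W where "V = \<Union>\<Gamma>" and "W = \<Union>\<Delta>"
  have fin: "finite V" "finite W" and WV: "W \<subseteq> V"
    using \<Delta> \<Gamma> sub by (auto simp: V_def W_def simplicial_complexD Union_mono)
  have dc: "down_closed \<Delta>" "down_closed \<Gamma>" using \<Delta> \<Gamma> by (simp_all add: simplicial_complexD)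
  define S where "S = (polys V :: (('v \<Rightarrow>\<^sub>0 nat) \<Rightarrow>\<^sub>0 'k) set)"
  interpret V: noetherian_subring S unfolding S_def by (rule noetherian_subring_polys[OF fin(1)])
  interpret W: subring_set "polys W :: (('v \<Rightarrow>\<^sub>0 nat) \<Rightarrow>\<^sub>0 'k) set" by (rule subring_set_polys)
  define m where "m = (face_ideal V {{}} :: (('v \<Rightarrow>\<^sub>0 nat) \<Rightarrow>\<^sub>0 'k) set)"
  define I where "I = (face_ideal V \<Gamma> :: (('v \<Rightarrow>\<^sub>0 nat) \<Rightarrow>\<^sub>0 'k) set)"
  define J where "J = (face_ideal V \<Delta> :: (('v \<Rightarrow>\<^sub>0 nat) \<Rightarrow>\<^sub>0 'k) set)"
  have I: "V.ideal_in I" and J: "V.ideal_in J" and IJ: "I \<subseteq> J"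
    unfolding I_def J_def S_def by (simp_all add: ideal_in_face_ideal dc face_ideal_antimono sub)
  have m: "V.prime_in m" unfolding m_def S_def by (rule prime_in_irrelevant)
  then have m_ideal: "V.ideal_in m" by (rule V.prime_in_ideal)
  have IS: "I \<subseteq> S" and JS: "J \<subseteq> S" using I J by (auto simp: V.ideal_in_def)
  let ?R = "ring_of S"
  have rel_depth: "\<lbrakk>carrier (quotient_module ?R J I) \<noteq> {\<zero>\<^bsub>quotient_module ?R J I\<^esub>}\<rbrakk> \<Longrightarrow>
      depth ?R m (quotient_module ?R J I) = module_dim ?R (quotient_module ?R J I)"
    using rel fin dc unfolding relative_cohen_macaulay_def cm_module_def poly_ring_eq_ring_of
    by (simp add: sr_ideal_eq_face_ideal irrelevant_ideal_eq_face_ideal S_def I_def J_def m_def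
        flip: V_def)
  have "sr_depth k \<Gamma> = depth ?R m (quotient_module ?R S I)"
    using fin dc by (simp add: sr_depth_def Let_def poly_ring_eq_ring_of sr_ideal_eq_face_ideal
        irrelevant_ideal_eq_face_ideal S_def I_def m_def flip: V_def)
  then have "enat (Suc g) < depth ?R m (quotient_module ?R S I)" using depth by simp
  then have depth_I: "depth_ge m (Suc (Suc g)) S I"
    by (rule V.depth_ge_if_less_depth[OF I V.ideal_in_whole IS m_ideal])
  have depth_J: "depth_ge m (Suc g) S J"
  proof (cases "J = I")
    case True
    have "depth_ge m (Suc g) S I" by (rule depth_ge_mono[OF depth_I]) simp
    then show ?thesis by (simp only: True)
  next
    case False
    then obtain a where a: "a \<in> J" "a \<notin> I" using IJ by blast
    have aS: "a \<in> S" using a(1) JS by blast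
    have "a \<notin> V.vanishes_locally m I"
    proof
      assume "a \<in> V.vanishes_locally m I"
      then obtain s where s: "s \<in> S" "s \<notin> m" "s * a \<in> I" by (auto simp: V.vanishes_locally_def)
      then have "Poly_Mapping.lookup s 0 \<noteq> 0" by (simp add: m_def S_def in_irrelevant_iff)
      then show False
        using face_ideal_saturated[OF dc(2) _ aS[unfolded S_def], of s] s(3) a(2) by (simp add: I_def)
    qed
    from V.prime_chain_from_depth[OF m I aS this depth_I]
    obtain P where P: "\<forall>i\<le>Suc (Suc g). V.prime_in (P i)" "\<forall>i<Suc (Suc g). P i \<subset> P (Suc i)"
      "V.ann_mod I a \<subseteq> P 0" by (elim exE conjE)
    define A where "A = annihilator ?R (quotient_module ?R J I)"
    have A_eq: "A = {r \<in> S. \<forall>x\<in>J. r * x \<in> I}"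
      unfolding A_def by (rule V.annihilator_quotient_module[OF I J IJ])
    have "V.ideal_in A" unfolding A_eq
      by (rule V.ideal_inI)
        (auto simp: V.ideal_in_zero[OF I] distrib_right mult.assoc V.ideal_in_add[OF I] V.ideal_in_mult[OF I])
    moreover have "A \<subseteq> P 0" using P(3) a(1) by (auto simp: A_eq V.ann_mod_def)
    ultimately have "enat (Suc (Suc g)) \<le> krull_dim (?R Quot A)"
      using P(1,2) by (rule V.krull_dim_ge_prime_chain)
    then have dim: "enat (Suc (Suc g)) \<le> module_dim ?R (quotient_module ?R J I)"
      by (simp add: module_dim_def A_def)
    have "I +>\<^bsub>?R\<^esub> a \<noteq> I +>\<^bsub>?R\<^esub> 0" using V.coset_eq_iff[OF I aS V.zero_closed] a(2) by simp
    then have "carrier (quotient_module ?R J I) \<noteq> {\<zero>\<^bsub>quotient_module ?R J I\<^esub>}"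
      using a(1) by (auto simp: V.quotient_module_carrier[OF I J IJ] V.quotient_module_zero[OF I J IJ])
    from rel_depth[OF this] dim
    have "enat (Suc g) < depth ?R m (quotient_module ?R J I)"
      by (metis enat_ord_simps(2) lessI order_less_le_trans)
    then have "depth_ge m (Suc (Suc g)) J I"
      by (rule V.depth_ge_if_less_depth[OF I J IJ m_ideal])
    then show ?thesis
      using depth_ge_mono[OF depth_I, of "Suc g"]
      by (intro V.depth_lemma[OF V.ideal_in_whole m_ideal I J IJ JS]) simp_all
  qed
  define mW where "mW = (face_ideal W {{}} :: (('v \<Rightarrow>\<^sub>0 nat) \<Rightarrow>\<^sub>0 'k) set)"
  have "depth_ge mW (Suc g) (restrict_vars W ` S) (restrict_vars W ` J)"
  proof (rule depth_ge_image[OF V.subring_set_axioms J _ _ restrict_vars_add restrict_vars_mult _ depth_J])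
    show "m \<subseteq> S" using m_ideal by (auto simp: V.ideal_in_def)
    show "restrict_vars W ` m \<subseteq> mW" unfolding m_def mW_def by (simp add: restrict_vars_image_face_ideal[OF WV])
    have face_sub: "\<sigma> \<subseteq> W" if "\<sigma> \<in> \<Delta>" for \<sigma> using that by (auto simp: W_def)
    show "{x \<in> S. restrict_vars W x = 0} \<subseteq> J"
      using face_sub by (fastforce simp: J_def face_ideal_def S_def restrict_vars_eq_0_iff)
  qed
  then have "depth_ge mW (Suc g) (polys W) (face_ideal W \<Delta>)"
    by (simp add: S_def J_def restrict_vars_image_polys[OF WV] restrict_vars_image_face_ideal[OF WV])
  moreover have "W.prime_in mW" unfolding mW_def by (rule prime_in_irrelevant)
  moreover have "face_ideal W \<Delta> \<subseteq> mW" unfolding mW_def using empty by (intro face_ideal_antimono) simp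
  ultimately have "enat (Suc g) \<le> depth (ring_of (polys W)) mW
      (quotient_module (ring_of (polys W)) (polys W) (face_ideal W \<Delta>))"
    by (intro W.depth_ge_le_depth ideal_in_face_ideal dc W.prime_in_ideal) (simp_all add: W.prime_in_def)
  then show ?thesis
    using fin dc by (simp add: sr_depth_def Let_def poly_ring_eq_ring_of sr_ideal_eq_face_ideal
        irrelevant_ideal_eq_face_ideal mW_def flip: W_def)
qed

text \<open>The depth of an extender equals its dimension, which is at least the dimension of \<open>\<Delta>\<close>, so the
  previous lemma makes the depth of \<open>\<Delta>\<close> at least its dimension minus one.\<close>

theorem proposition6p2:
  fixes k :: "'k::field itself" and \<Delta> :: "'v set set"
  assumes "simplicial_complex \<Delta>" and "pure_complex \<Delta>"
    and "sr_depth k \<Delta> + 1 < sr_dim k \<Delta>"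
  shows "\<not> (\<exists>\<Gamma> :: 'v set set. cm_extender k \<Delta> \<Gamma>)"
proof
  assume "\<exists>\<Gamma>. cm_extender k \<Delta> \<Gamma>"
  then obtain \<Gamma> :: "'v set set" where \<Gamma>: "simplicial_complex \<Gamma>" "\<Delta> \<subseteq> \<Gamma>"
    "sr_depth k \<Gamma> = sr_dim k \<Gamma>" "relative_cohen_macaulay k \<Gamma> \<Delta>"
    by (auto simp: cm_extender_def cohen_macaulay_def)
  obtain g where g: "sr_depth k \<Delta> = enat g" using assms(3) by (cases "sr_depth k \<Delta>") auto
  have "enat (Suc g) < sr_dim k \<Delta>" using assms(3) g by (simp add: one_enat_def)
  also have "\<dots> \<le> sr_depth k \<Gamma>" using sr_dim_mono[OF assms(1) \<Gamma>(1,2), of k] \<Gamma>(3) by simp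
  finally have "enat (Suc g) < sr_depth k \<Gamma>" .
  moreover have "{} \<in> \<Delta>"
    by (rule empty_face_if_sr_dim_pos[OF assms(1), of k]) (use assms(3) in \<open>auto intro: le_less_trans[OF zero_le]\<close>)
  ultimately have "enat (Suc g) \<le> sr_depth k \<Delta>"
    using depth_drop_at_most_one[OF \<Gamma>(1) assms(1) \<Gamma>(2) _ \<Gamma>(4)] by blast
  then show False by (simp add: g)
qed

end
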